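(* For every integer $n\ge 1$, the unit hypercube $Q_n=[-1/2,1/2]^n\subset\mathbb{R}^n$ contains an $n$-dimensional regular simplex with barycenter at the origin and with edge length $$\frac{\sqrt{336}-4-\sqrt{2}}{\sqrt{664}}\,\sqrt{n}.$$
   Context: An $n$-dimensional regular simplex of edge length $\ell>0$ is the convex hull of $n+1$ points of $\mathbb{R}^n$ whose pairwise Euclidean distances are all equal to $\ell$. Its barycenter is the arithmetic mean of its $n+1$ vertices. *)

theory Defs
  imports "HOL-Analysis.Analysis"
begin

text \<open>The dimension is the cardinality of the index type: \<open>n = CARD('n)\<close>.
  A simplex is represented by its set \<open>V\<close> of vertices; the solid itself is \<open>convex hull V\<close>.\<close>

definition regular_simplex_vertices :: "real \<Rightarrow> (real ^ 'n) set \<Rightarrow> bool" where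
  "regular_simplex_vertices l V \<longleftrightarrow>
     l > 0 \<and> finite V \<and> card V = CARD('n) + 1 \<and>
     (\<forall>x\<in>V. \<forall>y\<in>V. x \<noteq> y \<longrightarrow> dist x y = l)"

definition vertex_barycenter :: "(real ^ 'n) set \<Rightarrow> real ^ 'n" where
  "vertex_barycenter V = (1 / real (card V)) *\<^sub>R (\<Sum>v\<in>V. v)"

definition unit_hypercube :: "(real ^ 'n) set" where
  "unit_hypercube = {x. \<forall>i. - (1/2) \<le> x $ i \<and> x $ i \<le> 1/2}"

end

theory Submission
  imports Defs "HOL-Number_Theory.Number_Theory" "HOL-Combinatorics.Transposition"
begin

text \<open>
  A regular \<open>n\<close>-simplex centred at the origin corresponds, up to scaling, to an orthogonal matrix of
  order \<open>N = n + 1\<close> whose first row is constant: the columns of the remaining rows are the vertices.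
  So one needs such a matrix for every \<open>N\<close>, with entries of size at most about \<open>1.4107 / sqrt n\<close>.
  The real Fourier matrix (entries up to \<open>sqrt (2 / N)\<close>) suffices for \<open>n \<le> 201\<close>, and in general it
  misses the bound by a quarter of a percent.

  If \<open>q\<close> is odd and coprime to \<open>N\<close>, multiplication by \<open>q\<close> permutes the frequencies and induces, after
  a choice of phases, an orthogonal operator \<open>S\<close> on the rows. The all-pass filter
  \<open>(1 - a S) (1 - a S\<^sup>-\<^sup>1)\<^sup>-\<^sup>1\<close> replaces a row \<open>cos \<theta>\<close> by
  \<open>(1 - a\<^sup>2) (cos \<theta> + a cos y) - a cos (q \<theta>)\<close> up to second order in \<open>a\<close>, where the phases can be
  chosen such that \<open>\<theta> = q y + \<pi>\<close>. Near \<open>\<theta> = 0\<close> the term \<open>- a cos (q \<theta>)\<close> lowers the peak by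
  \<open>a\<close>, whereas \<open>y\<close> stays at distance \<open>\<pi> / q\<close> from \<open>0\<close>, so that \<open>a cos y\<close> only gives back a part.
  This settles all \<open>N\<close> not divisible by \<open>3\<close> (gain of more than 4 percent) or by \<open>5\<close>, and
  small \<open>N\<close> not divisible by \<open>7\<close>. Deleting a row and a column costs a factor of about
  \<open>1 + 1.4 / sqrt N\<close>; hence a large multiple \<open>N\<close> of \<open>15\<close> is reached from \<open>N + 1\<close>, and the
  few remaining multiples of \<open>105\<close> from Hadamard matrices of Paley type.
\<close>

section \<open>Flat orthogonal matrices\<close>

text \<open>The entries are at most \<open>1 / f\<close>, so a larger \<open>f\<close> means a
  flatter matrix; the product form makes sense for every real \<open>f\<close>. The extreme case
  \<open>f = sqrt N\<close> is that of normalised Hadamard matrices.\<close>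

definition flat_orthogonal :: "nat \<Rightarrow> real \<Rightarrow> bool" where
  "flat_orthogonal N f \<longleftrightarrow> (\<exists>U :: nat \<Rightarrow> nat \<Rightarrow> real.
     (\<forall>i<N. \<forall>k<N. (\<Sum>j<N. U i j * U k j) = (if i = k then 1 else 0)) \<and>
     (\<forall>j<N. U 0 j = 1 / sqrt N) \<and>
     (\<forall>i<N. \<forall>j<N. \<bar>U i j\<bar> * f \<le> 1))"

lemma flat_orthogonalI:
  fixes U :: "nat \<Rightarrow> nat \<Rightarrow> real"
  assumes "\<And>i k. i < N \<Longrightarrow> k < N \<Longrightarrow> (\<Sum>j<N. U i j * U k j) = (if i = k then 1 else 0)"
    and "\<And>j. j < N \<Longrightarrow> U 0 j = 1 / sqrt N"
    and "\<And>i j. i < N \<Longrightarrow> j < N \<Longrightarrow> \<bar>U i j\<bar> * f \<le> 1"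
  shows "flat_orthogonal N f"
  unfolding flat_orthogonal_def using assms by blast

lemma flat_orthogonal_mono:
  assumes "flat_orthogonal N f" "f' \<le> f"
  shows "flat_orthogonal N f'"
proof -
  obtain U where U: "\<forall>i<N. \<forall>k<N. (\<Sum>j<N. U i j * U k j) = (if i = k then 1 else 0)"
     "\<forall>j<N. U 0 j = 1 / sqrt N" "\<forall>i<N. \<forall>j<N. \<bar>U i j\<bar> * f \<le> 1"
    using assms(1) unfolding flat_orthogonal_def by blast
  have "\<bar>U i j\<bar> * f' \<le> 1" if "i < N" "j < N" for i j
    using mult_left_mono[OF assms(2), of "\<bar>U i j\<bar>"] U(3) that by (meson abs_ge_zero order_trans)
  then show ?thesis using U(1,2) by (intro flat_orthogonalI[of N U]) blast+
qed

section \<open>Doubling the order\<close>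

lemma sum_lessThan_double:
  fixes g :: "nat \<Rightarrow> real"
  shows "(\<Sum>j<2*N. g j) = (\<Sum>j<N. g j) + (\<Sum>j<N. g (N + j))"
proof -
  have "{..<2*N} = {..<N} \<union> {N..<2*N}" by auto
  then have "(\<Sum>j<2*N. g j) = (\<Sum>j<N. g j) + (\<Sum>j=N..<2*N. g j)"
    by (simp add: sum.union_disjoint ivl_disj_int)
  also have "(\<Sum>j=N..<2*N. g j) = (\<Sum>j<N. g (N + j))"
    by (rule sum.reindex_bij_witness[of _ "\<lambda>j. N + j" "\<lambda>j. j - N"]) auto
  finally show ?thesis .
qed

text \<open>Sylvester's construction: the Kronecker product with the normalised Hadamard matrix of
  order 2.\<close>

lemma flat_orthogonal_double:
  assumes "flat_orthogonal N f"
  shows "flat_orthogonal (2 * N) (sqrt 2 * f)"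
proof -
  obtain U where U: "\<And>i k. i<N \<Longrightarrow> k<N \<Longrightarrow> (\<Sum>j<N. U i j * U k j) = (if i = k then 1 else 0)"
     "\<And>j. j<N \<Longrightarrow> U 0 j = 1 / sqrt N" "\<And>i j. i<N \<Longrightarrow> j<N \<Longrightarrow> \<bar>U i j\<bar> * f \<le> 1"
    using assms(1) unfolding flat_orthogonal_def by blast
  \<comment> \<open>\<open>r\<close> is the index inside a block, \<open>e\<close> the sign of the
    block.\<close>
  define r where "r i = (if i < N then i else i - N)" for i :: nat
  define e where "e i j = (if i \<ge> N \<and> j \<ge> N then -1 else 1 :: real)" for i j :: nat
  define V where "V i j = e i j * U (r i) (r j) / sqrt 2" for i j
  have r: "r i < N" if "i < 2*N" for i using that by (auto simp: r_def)
  show ?thesis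
  proof (rule flat_orthogonalI)
    fix i k assume ik: "i < 2*N" "k < 2*N"
    have 1: "(\<Sum>j<N. V i j * V k j) = (\<Sum>j<N. U (r i) j * U (r k) j) / 2"
      by (simp add: V_def e_def r_def sum_divide_distrib)
    have 2: "(\<Sum>j<N. V i (N+j) * V k (N+j)) = e i N * e k N * (\<Sum>j<N. U (r i) j * U (r k) j) / 2"
      by (simp add: V_def e_def r_def sum_divide_distrib sum_distrib_left)
    have "(\<Sum>j<2*N. V i j * V k j) = (1 + e i N * e k N) * (if r i = r k then 1 else 0) / 2"
      unfolding sum_lessThan_double 1 2 using U(1)[OF r r, OF ik] by (simp add: field_simps)
    also have "\<dots> = (if i = k then 1 else 0)"
      using ik by (auto simp: e_def r_def)
    finally show "(\<Sum>j<2*N. V i j * V k j) = (if i = k then 1 else 0)" .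
  next
    fix j assume j: "j < 2*N"
    then have "r 0 = 0" "e 0 j = 1" by (auto simp: r_def e_def)
    then show "V 0 j = 1 / sqrt (2 * N)" using U(2)[OF r[OF j]]
      by (simp add: V_def real_sqrt_mult)
  next
    fix i j assume ij: "i < 2*N" "j < 2*N"
    have "\<bar>V i j\<bar> * (sqrt 2 * f) = \<bar>U (r i) (r j)\<bar> * f"
      by (simp add: V_def e_def abs_mult)
    with U(3)[OF r r, OF ij] show "\<bar>V i j\<bar> * (sqrt 2 * f) \<le> 1" by linarith
  qed
qed

section \<open>Deleting a row and a column\<close>

text \<open>For \<open>E = 1 / f\<close> the right-hand side is \<open>1 / (f - 1)\<close>, and the
  left-hand side bounds the entries after a deletion; hence a deletion lowers \<open>f\<close> by
  only 1. The left-hand side increases with \<open>\<nu>\<close>, and \<open>key\<close> settles the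
  worst case \<open>\<nu> = E\<close>.\<close>

lemma delete_row_bound:
  fixes E M :: real
  assumes M: "M \<ge> 2" and E: "0 < E" "E < 1" and ME: "M * E\<^sup>2 \<ge> 1" and \<nu>: "0 \<le> \<nu>" "\<nu> \<le> E"
    and \<mu>: "\<mu> = sqrt (M / (M - 1))"
  shows "E + \<mu> * \<nu> / (1 + \<mu> * \<nu>) * (E + 1 / sqrt (M * (M - 1))) \<le> E / (1 - E)"
proof -
  let ?g = "1 / sqrt (M * (M - 1))"
  have \<mu>1: "\<mu> \<ge> 1" using M by (simp add: \<mu> field_simps)
  have \<mu>2: "\<mu>\<^sup>2 = 1 + 1 / (M - 1)" using M by (simp add: \<mu> field_simps)
  have "(\<mu> - 1) * 1 \<le> (\<mu> - 1) * (\<mu> + 1)" using \<mu>1 by (intro mult_left_mono) auto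
  also have "\<dots> = 1 / (M - 1)" using \<mu>2 by (simp add: algebra_simps power2_eq_square)
  finally have \<mu>m: "\<mu> - 1 \<le> 1 / (M - 1)" by simp
  have \<mu>g: "\<mu> * ?g = 1 / (M - 1)"
    using M by (simp add: \<mu> real_sqrt_divide real_sqrt_mult)
  have g0: "?g \<ge> 0" using M by simp
  have "\<mu> * (E + ?g) * (1 - E) = E - E\<^sup>2 + (\<mu> - 1) * E * (1 - E) + \<mu> * ?g * (1 - E)"
    by (simp add: algebra_simps power2_eq_square)
  also have "\<dots> \<le> E - E\<^sup>2 + 1 / (M - 1) * E * (1 - E) + 1 / (M - 1) * (1 - E)"
    using E mult_right_mono[OF \<mu>m, of "E * (1 - E)"] unfolding \<mu>g by (simp add: mult.assoc)
  also have "\<dots> = E - E\<^sup>2 + (1 - E\<^sup>2) / (M - 1)"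
    by (simp add: algebra_simps power2_eq_square diff_divide_distrib)
  \<comment> \<open>The assumption \<open>M * E\<^sup>2 \<ge> 1\<close> absorbs both the excess of
    \<open>\<mu>\<close> over 1 and the term \<open>1 / sqrt (M * (M - 1))\<close>.\<close>
  also have "(1 - E\<^sup>2) / (M - 1) \<le> E\<^sup>2"
    using M ME by (simp add: divide_le_eq algebra_simps)
  also have "E - E\<^sup>2 + E\<^sup>2 \<le> E * (1 + \<mu> * E)" using E \<mu>1 by simp
  finally have key: "\<mu> * (E + ?g) * (1 - E) \<le> E * (1 + \<mu> * E)" by simp
  have pos: "1 + \<mu> * E > 0" "1 + \<mu> * \<nu> > 0" using \<mu>1 E \<nu> by (auto intro!: add_pos_nonneg)
  have "\<mu> * \<nu> / (1 + \<mu> * \<nu>) \<le> \<mu> * E / (1 + \<mu> * E)"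
    using pos \<mu>1 \<nu> by (simp add: field_simps)
  then have "\<mu> * \<nu> / (1 + \<mu> * \<nu>) * (E + ?g) \<le> \<mu> * E / (1 + \<mu> * E) * (E + ?g)"
    using E g0 by (intro mult_right_mono) auto
  also have "\<dots> \<le> E * E / (1 - E)"
    using pos E mult_left_mono[OF key, of E] by (simp add: field_simps)
  finally have "E + \<mu> * \<nu> / (1 + \<mu> * \<nu>) * (E + ?g) \<le> E + E * E / (1 - E)" by simp
  also have "\<dots> = E / (1 - E)" using E by (simp add: field_simps)
  finally show ?thesis .
qed

lemma flat_orthogonal_le_sqrt:
  assumes "flat_orthogonal N f" "N \<ge> 1"
  shows "f \<le> sqrt N"
proof -
  obtain U :: "nat \<Rightarrow> nat \<Rightarrow> real" where "\<forall>j<N. U 0 j = 1 / sqrt N" "\<forall>i<N. \<forall>j<N. \<bar>U i j\<bar> * f \<le> 1"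
    using assms(1) unfolding flat_orthogonal_def by blast
  then have "\<bar>1 / sqrt N\<bar> * f \<le> 1" using assms(2) by (metis less_le_trans zero_less_one)
  then show ?thesis using assms(2) by (simp add: field_simps)
qed

text \<open>The quadratic in \<open>\<beta>\<close> is the coefficient of
  \<open>V i m * V k m\<close> in the Gram matrix of the corrected rows; its vanishing makes them
  orthonormal.\<close>

lemma delete_row_coefficient:
  fixes m \<nu> \<mu> \<beta> \<gamma> :: real
  assumes m: "m > 0" and \<nu>: "\<nu> \<ge> 0" and \<mu>: "\<mu> = sqrt ((m + 1) / m)"
    and \<beta>: "\<beta> = \<mu> / (1 + \<mu> * \<nu>)" and \<gamma>: "\<gamma> = 1 / sqrt ((m + 1) * m)"
  shows "- 1 + 2 * \<beta> * (\<nu> - \<gamma>) + \<beta>\<^sup>2 * (1 - \<nu>\<^sup>2 + 2 * \<gamma> * \<nu> + \<gamma>\<^sup>2 * m) = 0"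
proof -
  have \<mu>0: "\<mu> > 0" using m by (simp add: \<mu>)
  have \<mu>2: "\<mu>\<^sup>2 = 1 + 1 / m" using m by (simp add: \<mu> field_simps)
  have \<mu>\<gamma>: "\<mu> * \<gamma> = 1 / m" using m by (simp add: \<mu> \<gamma> real_sqrt_divide real_sqrt_mult)
  define d where "d = 1 + \<mu> * \<nu>"
  have d: "d > 0" using \<mu>0 \<nu> unfolding d_def by (simp add: add_pos_nonneg)
  have \<beta>d: "\<beta> * d = \<mu>" using d by (simp add: \<beta> d_def)
  \<comment> \<open>Multiplying by \<open>d\<^sup>2\<close> clears the denominator of
    \<open>\<beta>\<close>; then all terms in \<open>\<nu>\<close> cancel.\<close>
  have "(- 1 + 2 * \<beta> * (\<nu> - \<gamma>) + \<beta>\<^sup>2 * (1 - \<nu>\<^sup>2 + 2 * \<gamma> * \<nu> + \<gamma>\<^sup>2 * m)) * d\<^sup>2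
      = - d\<^sup>2 + 2 * (\<beta> * d) * (\<nu> - \<gamma>) * d + (\<beta> * d)\<^sup>2 * (1 - \<nu>\<^sup>2 + 2 * \<gamma> * \<nu> + \<gamma>\<^sup>2 * m)"
    by (simp add: algebra_simps power2_eq_square)
  also have "\<dots> = - 1 - 2 * (\<mu> * \<gamma>) + \<mu>\<^sup>2 + (\<mu> * \<gamma>)\<^sup>2 * m"
    unfolding \<beta>d unfolding d_def by (simp add: algebra_simps power2_eq_square)
  also have "\<dots> = 0" unfolding \<mu>2 \<mu>\<gamma> using m by (simp add: field_simps power2_eq_square)
  finally show ?thesis using d by simp
qed

text \<open>The deleted row is one with the largest entry in the deleted column, and its sign is chosen to
  make that entry nonpositive; this keeps the correction \<open>\<beta> V i m\<close> of the other rows small. The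
  values of \<open>\<beta>\<close> and \<open>\<gamma>\<close> are forced by orthogonality.\<close>

lemma flat_orthogonal_delete:
  assumes "flat_orthogonal M f" and M: "M \<ge> 3" and f: "f > 1"
  shows "flat_orthogonal (M - 1) (f - 1)"
proof -
  obtain U where U: "\<And>i k. i<M \<Longrightarrow> k<M \<Longrightarrow> (\<Sum>j<M. U i j * U k j) = (if i = k then 1 else 0)"
     "\<And>j. j<M \<Longrightarrow> U 0 j = 1 / sqrt M" "\<And>i j. i<M \<Longrightarrow> j<M \<Longrightarrow> \<bar>U i j\<bar> * f \<le> 1"
    using assms(1) unfolding flat_orthogonal_def by blast
  define m where "m = M - 1"
  have Mm: "M = Suc m" "m \<ge> 2" using M by (auto simp: m_def)
  have "Max ((\<lambda>i. \<bar>U i m\<bar>) ` {1..m}) \<in> (\<lambda>i. \<bar>U i m\<bar>) ` {1..m}"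
    using Mm by (intro Max_in) auto
  then obtain t where t: "t \<in> {1..m}" "\<bar>U t m\<bar> = Max ((\<lambda>i. \<bar>U i m\<bar>) ` {1..m})" by auto
  have t_max: "\<bar>U i m\<bar> \<le> \<bar>U t m\<bar>" if "i \<in> {1..m}" for i
    unfolding t(2) using that by (intro Max_ge) auto
  \<comment> \<open>The swap moves the row to be deleted to the last place \<open>m\<close> and
    fixes row 0.\<close>
  define \<sigma> where "\<sigma> = Transposition.transpose t m"
  have \<sigma>_lt: "\<sigma> i < M" if "i < M" for i using that t(1) Mm by (auto simp: \<sigma>_def Transposition.transpose_def)
  have \<sigma>_inj: "\<sigma> i = \<sigma> k \<longleftrightarrow> i = k" for i k unfolding \<sigma>_def by (metis transpose_involutory)
  have \<sigma>0: "\<sigma> 0 = 0" using t(1) Mm by (auto simp: \<sigma>_def Transposition.transpose_def)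
  have \<sigma>m: "\<sigma> m = t" by (simp add: \<sigma>_def)
  have \<sigma>1: "\<sigma> i \<in> {1..m}" if "i \<in> {1..m}" for i using that t(1) by (auto simp: \<sigma>_def Transposition.transpose_def)
  define s where "s i = (if i = m \<and> U t m > 0 then -1 else 1 :: real)" for i
  define V where "V i j = s i * U (\<sigma> i) j" for i j
  have V: "(\<Sum>j<M. V i j * V k j) = (if i = k then 1 else 0)" if "i < M" "k < M" for i k
  proof -
    have "(\<Sum>j<M. V i j * V k j) = s i * s k * (\<Sum>j<M. U (\<sigma> i) j * U (\<sigma> k) j)"
      by (simp add: V_def sum_distrib_left algebra_simps)
    then show ?thesis using U(1)[OF \<sigma>_lt \<sigma>_lt, OF that] by (simp add: \<sigma>_inj s_def)
  qed
  have V0: "V 0 j = 1 / sqrt M" if "j < M" for j using that Mm U(2) by (simp add: V_def \<sigma>0 s_def)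
  have Vf: "\<bar>V i j\<bar> * f \<le> 1" if "i < M" "j < M" for i j
    using U(3)[OF \<sigma>_lt[OF that(1)] that(2)] by (auto simp: V_def abs_mult s_def)
  define \<nu> where "\<nu> = - V m m"
  have \<nu>0: "\<nu> \<ge> 0" by (simp add: \<nu>_def V_def \<sigma>m s_def)
  have \<nu>_abs: "\<nu> = \<bar>U t m\<bar>" by (simp add: \<nu>_def V_def \<sigma>m s_def)
  have V\<nu>: "\<bar>V i m\<bar> \<le> \<nu>" if "i \<in> {1..m}" for i
    using t_max[OF \<sigma>1[OF that]] by (auto simp add: \<nu>_abs V_def abs_mult s_def)
  have A: "(\<Sum>j<m. V i j * V k j) = (if i = k then 1 else 0) - V i m * V k m" if "i < M" "k < M" for i k
    using V[OF that] by (simp add: Mm)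
  have S: "(\<Sum>j<m. V i j) = - V i m" if "i \<in> {1..m}" for i
  proof -
    have "(\<Sum>j<M. V 0 j * V i j) = 0" using V[of 0 i] that Mm by simp
    moreover have "(\<Sum>j<M. V 0 j * V i j) = (\<Sum>j<M. V i j) / sqrt M"
      by (simp add: V0 sum_divide_distrib)
    ultimately have "(\<Sum>j<M. V i j) = 0" using M by simp
    then show ?thesis by (simp add: Mm)
  qed
  define \<mu> where "\<mu> = sqrt ((real m + 1) / m)"
  define \<beta> where "\<beta> = \<mu> / (1 + \<mu> * \<nu>)"
  define \<gamma> where "\<gamma> = 1 / sqrt ((real m + 1) * m)"
  have mpos: "real m > 0" using Mm by simp
  note coef = delete_row_coefficient[OF mpos \<nu>0 \<mu>_def \<beta>_def \<gamma>_def]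
  \<comment> \<open>Dropping coordinate \<open>m\<close> perturbs the Gram matrix by
    \<open>- V i m * V k m\<close>. A multiple of the deleted row plus a constant vector compensates
    for this and makes the rows orthogonal to the new, shorter constant row.\<close>
  define W where "W i j = (if i = 0 then 1 / sqrt m else V i j + \<beta> * V i m * (V m j + \<gamma>))" for i j
  have W_sum: "(\<Sum>j<m. W i j) = 0" if i: "i \<in> {1..m}" for i
  proof -
    have "(\<Sum>j<m. W i j) = (\<Sum>j<m. V i j) + \<beta> * V i m * ((\<Sum>j<m. V m j) + m * \<gamma>)"
      using i by (simp add: W_def sum.distrib sum_distrib_left algebra_simps)
    also have "\<dots> = V i m * (- 1 + \<beta> * (\<nu> + m * \<gamma>))"
      using i by (simp add: S \<nu>_def algebra_simps)
    also have "\<beta> * (\<nu> + m * \<gamma>) = 1"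
    proof -
      have "\<mu> * \<gamma> = 1 / m" using mpos by (simp add: \<gamma>_def \<mu>_def real_sqrt_divide real_sqrt_mult)
      then have "m * (\<mu> * \<gamma>) = 1" using mpos by simp
      then have "\<mu> * (\<nu> + m * \<gamma>) = 1 + \<mu> * \<nu>" by (simp add: algebra_simps)
      moreover have "1 + \<mu> * \<nu> > 0" using \<nu>0 mpos by (simp add: \<mu>_def add_pos_nonneg)
      ultimately show ?thesis by (simp add: \<beta>_def)
    qed
    finally show ?thesis by simp
  qed
  have W_orth: "(\<Sum>j<m. W i j * W k j) = (if i = k then 1 else 0)"
    if i: "i \<in> {1..<m}" and k: "k \<in> {1..<m}" for i k
  proof -
    have "(\<Sum>j<m. W i j * W k j) = (\<Sum>j<m. V i j * V k j)
        + \<beta> * V k m * ((\<Sum>j<m. V i j * V m j) + \<gamma> * (\<Sum>j<m. V i j))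
        + \<beta> * V i m * ((\<Sum>j<m. V k j * V m j) + \<gamma> * (\<Sum>j<m. V k j))
        + \<beta>\<^sup>2 * V i m * V k m * ((\<Sum>j<m. V m j * V m j) + 2 * \<gamma> * (\<Sum>j<m. V m j) + \<gamma>\<^sup>2 * m)"
      using i k by (simp add: W_def sum.distrib sum_distrib_left algebra_simps power2_eq_square)
    also have "\<dots> = (if i = k then 1 else 0)
        + V i m * V k m * (- 1 + 2 * \<beta> * (\<nu> - \<gamma>) + \<beta>\<^sup>2 * (1 - \<nu>\<^sup>2 + 2 * \<gamma> * \<nu> + \<gamma>\<^sup>2 * m))"
      using i k Mm by (simp add: A S \<nu>_def algebra_simps power2_eq_square)
    finally show ?thesis unfolding coef by simp
  qed
  have "flat_orthogonal m (f - 1)"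
  proof (rule flat_orthogonalI)
    fix i k assume ik: "i < m" "k < m"
    consider "i = 0" "k = 0" | "i = 0" "k \<in> {1..<m}" | "k = 0" "i \<in> {1..<m}" | "i \<in> {1..<m}" "k \<in> {1..<m}"
      using ik by force
    then show "(\<Sum>j<m. W i j * W k j) = (if i = k then 1 else 0)"
    proof cases
      case 1
      then show ?thesis using mpos by (simp add: W_def)
    next
      case 2
      then have "(\<Sum>j<m. W i j * W k j) = (\<Sum>j<m. W k j) / sqrt m"
        by (simp add: W_def sum_divide_distrib)
      then show ?thesis using 2 W_sum[of k] by simp
    next
      case 3
      then have "(\<Sum>j<m. W i j * W k j) = (\<Sum>j<m. W i j) / sqrt m"
        by (simp add: W_def sum_divide_distrib)
      then show ?thesis using 3 W_sum[of i] by simp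
    next
      case 4
      then show ?thesis by (rule W_orth)
    qed
  next
    fix j assume "j < m"
    then show "W 0 j = 1 / sqrt m" by (simp add: W_def)
  next
    fix i j assume ij: "i < m" "j < m"
    have fM: "f \<le> sqrt M" using flat_orthogonal_le_sqrt[OF assms(1)] M by simp
    show "\<bar>W i j\<bar> * (f - 1) \<le> 1"
    proof (cases "i = 0")
      case True
      have "f \<le> sqrt m + 1"
      proof -
        have "sqrt M \<le> sqrt m + sqrt 1" using sqrt_add_le_add_sqrt[of "real m" 1] by (simp add: Mm add.commute)
        then show ?thesis using fM by simp
      qed
      then show ?thesis using True mpos by (simp add: W_def field_simps)
    next
      case False
      define E where "E = 1 / f"
      have E: "0 < E" "E < 1" using f by (auto simp: E_def)
      have VE: "\<bar>V i j\<bar> \<le> E" if "i < M" "j < M" for i j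
        using Vf[OF that] f by (simp add: E_def field_simps)
      have "f\<^sup>2 \<le> M" using power_mono[OF fM, of 2] f by simp
      then have ME: "real M * E\<^sup>2 \<ge> 1" using f by (simp add: E_def power_divide)
      have \<nu>E: "\<nu> \<le> E" using VE[of m m] Mm \<nu>0 by (simp add: \<nu>_def)
      have \<mu>': "\<mu> = sqrt (real M / (real M - 1))" and \<gamma>': "\<gamma> = 1 / sqrt (real M * (real M - 1))"
        by (simp_all add: \<mu>_def \<gamma>_def Mm add.commute)
      have bound: "E + \<mu> * \<nu> / (1 + \<mu> * \<nu>) * (E + \<gamma>) \<le> E / (1 - E)"
        unfolding \<gamma>' using delete_row_bound[OF _ E ME \<nu>0 \<nu>E \<mu>'] M by simp
      have \<mu>0: "\<mu> \<ge> 0" using mpos by (simp add: \<mu>_def)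
      then have \<beta>0: "\<beta> \<ge> 0" using \<nu>0 by (simp add: \<beta>_def)
      have \<gamma>0: "\<gamma> \<ge> 0" using mpos by (simp add: \<gamma>_def)
      have "\<bar>W i j\<bar> \<le> \<bar>V i j\<bar> + \<bar>\<beta> * V i m * (V m j + \<gamma>)\<bar>"
        using False by (simp add: W_def)
      also have "\<dots> \<le> E + \<beta> * \<nu> * (E + \<gamma>)"
      proof (rule add_mono)
        show "\<bar>V i j\<bar> \<le> E" using VE ij Mm by simp
        have "\<bar>V m j + \<gamma>\<bar> \<le> E + \<gamma>" using VE[of m j] ij Mm \<gamma>0 by simp
        moreover have "\<bar>V i m\<bar> \<le> \<nu>" using V\<nu>[of i] ij False by simp
        ultimately show "\<bar>\<beta> * V i m * (V m j + \<gamma>)\<bar> \<le> \<beta> * \<nu> * (E + \<gamma>)"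
          using \<beta>0 \<nu>0 by (simp add: abs_mult mult_mono)
      qed
      also have "\<dots> \<le> E / (1 - E)" using bound by (simp add: \<beta>_def)
      also have "\<dots> = 1 / (f - 1)" using f by (simp add: E_def field_simps)
      finally show ?thesis using f by (simp add: field_simps)
    qed
  qed
  then show ?thesis by (simp add: m_def)
qed

section \<open>From orthogonal matrices to simplices\<close>

text \<open>A right inverse of a square matrix is also a left inverse. The type \<open>'a\<close>
  provides \<open>N\<close> indices for the matrix.\<close>

lemma columns_orthonormal:
  fixes U :: "nat \<Rightarrow> nat \<Rightarrow> real"
  assumes rows: "\<And>i k. i < N \<Longrightarrow> k < N \<Longrightarrow> (\<Sum>j<N. U i j * U k j) = (if i = k then 1 else 0)"
    and N: "N = CARD('a::finite)" and jl: "j < N" "l < N"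
  shows "(\<Sum>i<N. U i j * U i l) = (if j = l then 1 else 0)"
proof -
  obtain h where h: "bij_betw h (UNIV :: 'a set) {..<N}"
    using ex_bij_betw_finite_nat[of "UNIV :: 'a set"] N by (auto simp: lessThan_atLeast0)
  have hN: "h x < N" for x using h by (auto simp: bij_betw_def)
  have hinj: "h x = h y \<longleftrightarrow> x = y" for x y using h by (auto simp: bij_betw_def inj_def)
  have reidx: "(\<Sum>x\<in>UNIV. g (h x)) = (\<Sum>i<N. g i)" for g :: "nat \<Rightarrow> real"
    by (rule sum.reindex_bij_betw[OF h])
  define A :: "real^'a^'a" where "A = (\<chi> x y. U (h x) (h y))"
  have "A ** Finite_Cartesian_Product.transpose A = mat 1"
    unfolding vec_eq_iff
  proof (intro allI)
    fix x y :: 'a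
    have "(A ** Finite_Cartesian_Product.transpose A) $ x $ y = (\<Sum>z\<in>UNIV. U (h x) (h z) * U (h y) (h z))"
      by (simp add: A_def matrix_matrix_mult_def Finite_Cartesian_Product.transpose_def)
    also have "\<dots> = (\<Sum>j<N. U (h x) j * U (h y) j)" by (rule reidx)
    also have "\<dots> = mat 1 $ x $ y" using rows[OF hN hN, of x y] by (simp add: hinj mat_def)
    finally show "(A ** Finite_Cartesian_Product.transpose A) $ x $ y = mat 1 $ x $ y" .
  qed
  then have B: "Finite_Cartesian_Product.transpose A ** A = mat 1"
    using matrix_left_right_inverse by blast
  obtain x y where xy: "h x = j" "h y = l"
    using jl h by (metis (no_types, opaque_lifting) bij_betw_def imageE lessThan_iff)
  have "(Finite_Cartesian_Product.transpose A ** A) $ x $ y = (\<Sum>z\<in>UNIV. U (h z) j * U (h z) l)"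
    by (simp add: A_def matrix_matrix_mult_def Finite_Cartesian_Product.transpose_def xy)
  also have "\<dots> = (\<Sum>i<N. U i j * U i l)" by (rule reidx)
  finally have "(Finite_Cartesian_Product.transpose A ** A) $ x $ y = (\<Sum>i<N. U i j * U i l)" .
  then show ?thesis using B by (simp add: mat_def xy[symmetric] hinj)
qed

text \<open>Distinct columns of an orthogonal matrix are \<open>sqrt 2\<close> apart and agree in
  row 0, so omitting row 0 and scaling by \<open>l / sqrt 2\<close> gives distance \<open>l\<close>.
  Orthogonality to row 0 centres the vertices, and \<open>l / (sqrt 2 * f) \<le> 1/2\<close> keeps
  them in the cube.\<close>

lemma regular_simplex_from_flat_orthogonal:
  assumes "flat_orthogonal (CARD('n) + 1) f" and l: "l > 0" "l * sqrt 2 \<le> f"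
  shows "\<exists>V :: (real ^ 'n) set. regular_simplex_vertices l V \<and>
    vertex_barycenter V = 0 \<and> convex hull V \<subseteq> unit_hypercube"
proof -
  define N where "N = CARD('n) + 1"
  have N0: "N > 0" by (simp add: N_def)
  obtain U where U: "\<And>i k. i<N \<Longrightarrow> k<N \<Longrightarrow> (\<Sum>j<N. U i j * U k j) = (if i = k then 1 else 0)"
     "\<And>j. j<N \<Longrightarrow> U 0 j = 1 / sqrt N" "\<And>i j. i<N \<Longrightarrow> j<N \<Longrightarrow> \<bar>U i j\<bar> * f \<le> 1"
    using assms(1) unfolding flat_orthogonal_def N_def by blast
  have "N = CARD('n option)" by (simp add: N_def)
  note col = columns_orthonormal[OF U(1) this]
  have "card (UNIV :: 'n set) = card {1..<N}" by (simp add: N_def)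
  then obtain b where b: "bij_betw b (UNIV :: 'n set) {1..<N}"
    using finite_same_card_bij[OF finite finite_atLeastLessThan] by blast
  have bN: "b i < N" "b i \<noteq> 0" for i using b by (force simp: bij_betw_def)+
  define v :: "nat \<Rightarrow> real ^ 'n" where "v j = (\<chi> i. l / sqrt 2 * U (b i) j)" for j
  have dist: "dist (v j) (v k) = l" if "j < N" "k < N" "j \<noteq> k" for j k
  proof -
    have "v j $ i - v k $ i = l / sqrt 2 * (U (b i) j - U (b i) k)" for i
      by (simp add: v_def algebra_simps)
    then have "(v j $ i - v k $ i)\<^sup>2 = l\<^sup>2 / 2 * (U (b i) j - U (b i) k)\<^sup>2" for i
      by (simp add: power_mult_distrib power_divide)
    then have "(\<Sum>i\<in>UNIV. (v j $ i - v k $ i)\<^sup>2) = (\<Sum>i\<in>UNIV. l\<^sup>2 / 2 * (U (b i) j - U (b i) k)\<^sup>2)"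
      by (simp only:)
    also have "\<dots> = (\<Sum>i=1..<N. l\<^sup>2 / 2 * (U i j - U i k)\<^sup>2)"
      by (rule sum.reindex_bij_betw[OF b])
    \<comment> \<open>Row 0 is constant, so the added term is zero.\<close>
    also have "\<dots> = (\<Sum>i<N. l\<^sup>2 / 2 * (U i j - U i k)\<^sup>2)"
      using U(2) that by (intro sum.mono_neutral_left) (auto simp: Suc_le_eq)
    also have "\<dots> = l\<^sup>2 / 2 * ((\<Sum>i<N. U i j * U i j) - 2 * (\<Sum>i<N. U i j * U i k) + (\<Sum>i<N. U i k * U i k))"
      by (simp add: sum_distrib_left sum_subtractf sum.distrib power2_eq_square algebra_simps)
    also have "\<dots> = l\<^sup>2" using col that by simp
    finally show ?thesis using l by (simp add: dist_vec_def L2_set_def dist_real_def)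
  qed
  have inj: "inj_on v {..<N}"
    using dist l by (metis dist_self inj_onI lessThan_iff less_irrefl)
  have cardV: "card (v ` {..<N}) = N" using inj by (simp add: card_image)
  have "(\<Sum>x\<in>v ` {..<N}. x) = (\<Sum>j<N. v j)" using inj by (simp add: sum.reindex)
  also have "\<dots> = 0"
  proof -
    have "(\<Sum>j<N. U (b i) j) = 0" for i
    proof -
      have "(\<Sum>j<N. U 0 j * U (b i) j) = 0" using U(1)[of 0 "b i"] bN[of i] by simp
      moreover have "(\<Sum>j<N. U 0 j * U (b i) j) = (\<Sum>j<N. U (b i) j) / sqrt N"
        by (simp add: U(2) sum_divide_distrib)
      ultimately show ?thesis using N0 by simp
    qed
    then show ?thesis by (simp add: vec_eq_iff v_def flip: sum_distrib_left sum_divide_distrib)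
  qed
  finally have bary: "vertex_barycenter (v ` {..<N}) = 0" by (simp add: vertex_barycenter_def)
  have "v j \<in> unit_hypercube" if "j < N" for j
  proof -
    have "\<bar>v j $ i\<bar> \<le> 1/2" for i
    proof -
      have "\<bar>U (b i) j\<bar> * (l * sqrt 2) \<le> \<bar>U (b i) j\<bar> * f" using l by (intro mult_left_mono) auto
      also have "\<dots> \<le> 1" using U(3) bN that by simp
      finally have "\<bar>U (b i) j\<bar> * (l * sqrt 2) \<le> 1" .
      moreover have "\<bar>v j $ i\<bar> = \<bar>U (b i) j\<bar> * (l * sqrt 2) / 2"
      proof -
        have half: "l / sqrt 2 = l * sqrt 2 / 2" by (simp add: field_simps)
        have "\<bar>v j $ i\<bar> = l / sqrt 2 * \<bar>U (b i) j\<bar>" using l by (simp add: v_def abs_mult)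
        then show ?thesis unfolding half by (simp add: mult.commute)
      qed
      ultimately show ?thesis by simp
    qed
    note bound = this
    have "- (1/2) \<le> v j $ i" "v j $ i \<le> 1/2" for i using bound[of i] by linarith+
    then show ?thesis by (simp add: unit_hypercube_def)
  qed
  moreover have "convex (unit_hypercube :: (real ^ 'n) set)"
  proof -
    have "(unit_hypercube :: (real ^ 'n) set) = cbox (\<chi> i. - (1/2)) (\<chi> i. 1/2)"
      by (auto simp: unit_hypercube_def mem_box_cart)
    then show ?thesis by (metis convex_box(1))
  qed
  ultimately have "convex hull (v ` {..<N}) \<subseteq> unit_hypercube"
    by (intro hull_minimal) auto
  moreover have "regular_simplex_vertices l (v ` {..<N})"
    unfolding regular_simplex_vertices_def using dist l cardV by (auto simp: N_def)
  ultimately show ?thesis using bary by blast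
qed

section \<open>Paley matrices\<close>

context
  fixes q :: nat
  assumes q_prime: "prime q" and q_mod_4: "q mod 4 = 3"
begin

private abbreviation leg :: "int \<Rightarrow> int" where "leg x \<equiv> Legendre x (int q)"

private lemma q_gt_2: "q > 2" using q_mod_4 by (cases "q \<le> 2") auto

private lemma leg_euler: "[leg a = a ^ ((q - 1) div 2)] (mod int q)"
proof (cases "[a = 0] (mod int q)")
  case True
  have "(q - 1) div 2 > 0" using q_gt_2 by simp
  then have "[a ^ ((q - 1) div 2) = 0 ^ ((q - 1) div 2)] (mod int q)" using True by (intro cong_pow)
  then show ?thesis using True \<open>(q - 1) div 2 > 0\<close> by (simp add: Legendre_def cong_sym zero_power)
next
  case False
  then show ?thesis using euler_criterion[OF q_prime q_gt_2] by simp
qed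

private lemma leg_range: "leg a \<in> {-1, 0, 1}" by (auto simp: Legendre_def)

text \<open>The two values differ by at most 2, which is less than \<open>q\<close>.\<close>

private lemma leg_eqI:
  assumes "[x = y] (mod int q)" "x \<in> {-1, 0, 1}" "y \<in> {-1, 0, 1}"
  shows "x = y"
proof -
  have "int q dvd x - y" using assms(1) by (simp add: cong_iff_dvd_diff)
  moreover have "\<bar>x - y\<bar> < int q" using assms(2,3) q_gt_2 by auto
  ultimately show ?thesis using zdvd_imp_le[of "int q" "\<bar>x - y\<bar>"] by (cases "x = y") auto
qed

private lemma leg_mult: "leg (x * y) = leg x * leg y"
proof (rule leg_eqI)
  have "[leg x * leg y = x ^ ((q - 1) div 2) * y ^ ((q - 1) div 2)] (mod int q)"
    by (intro cong_mult leg_euler)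
  then show "[leg (x * y) = leg x * leg y] (mod int q)"
    using leg_euler[of "x * y"] by (metis cong_sym cong_trans power_mult_distrib)
  show "leg (x * y) \<in> {-1, 0, 1}" by (rule leg_range)
  show "leg x * leg y \<in> {-1, 0, 1}" using leg_range[of x] leg_range[of y] by auto
qed

text \<open>For \<open>q mod 4 = 3\<close> the exponent in Euler's criterion is odd, so
  \<open>- 1\<close> is a non-residue.\<close>

private lemma leg_uminus: "leg (- x) = - leg x"
proof -
  have "leg (- 1) = - 1"
  proof (rule leg_eqI)
    have "odd ((q - 1) div 2)" using q_mod_4 by presburger
    then show "[leg (- 1) = - 1] (mod int q)" using leg_euler[of "-1"] by simp
  qed (use leg_range in auto)
  then show ?thesis using leg_mult[of "-1" x] by simp
qed

private lemma leg_mod: "leg (x mod int q) = leg x"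
  by (simp add: Legendre_def cong_def QuadRes_def)

private lemma leg_square: "leg x * leg x = (if int q dvd x then 0 else 1)"
  using leg_range[of x] by (auto simp: Legendre_def cong_0_iff)

text \<open>Change of summation variable: a map that is injective modulo \<open>q\<close> permutes
  the residues.\<close>

private lemma sum_residues_bij:
  assumes g: "\<And>x. g (x mod int q) = g x"
    and inj: "\<And>x y. [h x = h y] (mod int q) \<Longrightarrow> [x = y] (mod int q)"
  shows "(\<Sum>x\<in>{0..<int q}. g (h x)) = (\<Sum>x\<in>{0..<int q}. g x :: int)"
proof -
  let ?h = "\<lambda>x. h x mod int q"
  have "inj_on ?h {0..<int q}"
    unfolding inj_on_def
  proof (intro ballI impI)
    fix x y assume xy: "x \<in> {0..<int q}" "y \<in> {0..<int q}" "?h x = ?h y"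
    then have "[x = y] (mod int q)" using inj[of x y] unfolding cong_def by blast
    then show "x = y" using xy by (simp add: cong_def)
  qed
  moreover have "?h ` {0..<int q} \<subseteq> {0..<int q}" using q_gt_2 by auto
  ultimately have "bij_betw ?h {0..<int q} {0..<int q}"
    unfolding bij_betw_def using endo_inj_surj[of "{0..<int q}" ?h] by blast
  from sum.reindex_bij_betw[OF this, of g] show ?thesis by (simp add: g)
qed

private lemma sum_leg: "(\<Sum>x\<in>{0..<int q}. leg x) = 0"
proof -
  have "(\<Sum>x\<in>{0..<int q}. leg (- x)) = (\<Sum>x\<in>{0..<int q}. leg x)"
    by (rule sum_residues_bij) (auto simp: leg_mod cong_minus_minus_iff)
  then show ?thesis by (simp add: leg_uminus sum_negf)
qed

private lemma sum_leg_shift: "(\<Sum>x\<in>{0..<int q}. leg (x + c)) = 0"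
proof -
  have "(\<Sum>x\<in>{0..<int q}. leg (x + c)) = (\<Sum>x\<in>{0..<int q}. leg x)"
    by (rule sum_residues_bij) (auto simp: leg_mod cong_add_rcancel)
  then show ?thesis by (simp add: sum_leg)
qed

text \<open>The correlation at shift \<open>c\<close> is the same for all \<open>c\<close> coprime to \<open>q\<close>, by rescaling the
  summation variable, and the correlations at all shifts add up to zero.\<close>

private lemma leg_correlation:
  assumes "\<not> int q dvd c"
  shows "(\<Sum>x\<in>{0..<int q}. leg x * leg (x + c)) = - 1"
proof -
  define F where "F c = (\<Sum>x\<in>{0..<int q}. leg x * leg (x + c))" for c
  have F1: "F c = F 1" if c: "\<not> int q dvd c" for c
  proof -
    have cop: "coprime c (int q)"
      using prime_imp_coprime[of "int q" c] c q_prime by (simp add: coprime_commute)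
    have "F c = (\<Sum>x\<in>{0..<int q}. leg (c * x) * leg (c * x + c))"
      unfolding F_def
    proof (rule sum_residues_bij[symmetric])
      show "[x = y] (mod int q)" if "[c * x = c * y] (mod int q)" for x y
        using that cop cong_mult_lcancel by blast
      show "leg (x mod int q) * leg (x mod int q + c) = leg x * leg (x + c)" for x
        by (metis leg_mod mod_add_left_eq)
    qed
    also have "\<dots> = (\<Sum>x\<in>{0..<int q}. (leg c * leg c) * (leg x * leg (x + 1)))"
      by (rule sum.cong) (simp_all add: leg_mult algebra_simps flip: leg_mult[of c "_ + 1", unfolded distrib_left mult_1_right])
    also have "\<dots> = F 1" using c by (simp add: leg_square F_def)
    finally show ?thesis .
  qed
  have F0: "F 0 = int q - 1"
  proof -
    have "F 0 = (\<Sum>x\<in>{0..<int q}. if x = 0 then 0 else 1)"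
      unfolding F_def by (intro sum.cong) (auto simp: leg_square zdvd_not_zless)
    also have "\<dots> = (\<Sum>x\<in>{0..<int q} - {0}. 1)"
      using q_gt_2 by (subst sum.remove[of _ 0]) (auto intro!: sum.cong)
    also have "\<dots> = int q - 1" using q_gt_2 by (simp add: card_Diff_singleton)
    finally show ?thesis .
  qed
  have "0 = (\<Sum>x\<in>{0..<int q}. leg x * (\<Sum>c\<in>{0..<int q}. leg (c + x)))"
    by (simp add: sum_leg_shift)
  also have "\<dots> = (\<Sum>c\<in>{0..<int q}. F c)"
    unfolding F_def sum_distrib_left by (subst sum.swap) (simp add: add.commute)
  also have "\<dots> = F 0 + (\<Sum>c\<in>{0..<int q} - {0}. F c)"
    using q_gt_2 by (subst sum.remove[of _ 0]) auto
  also have "(\<Sum>c\<in>{0..<int q} - {0}. F c) = (\<Sum>c\<in>{0..<int q} - {0}. F 1)"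
    by (intro sum.cong F1) (auto simp: zdvd_not_zless)
  also have "\<dots> = (int q - 1) * F 1" using q_gt_2 by (simp add: card_Diff_singleton)
  finally have "(int q - 1) * (1 + F 1) = 0" unfolding F0 by (simp add: distrib_left)
  then have "F 1 = - 1" using q_gt_2 by simp
  then show ?thesis using F1[OF assms] by (simp add: F_def)
qed

private lemma sum_nat_residues: "(\<Sum>y<q. g (int y)) = (\<Sum>x\<in>{0..<int q}. g x)"
  by (rule sum.reindex_bij_witness[of _ nat int]) auto

text \<open>Paley's first construction: the skew matrix of Legendre symbols, bordered by 1 and
  \<open>- 1\<close>, plus the identity is a Hadamard matrix.\<close>

lemma flat_orthogonal_paley: "flat_orthogonal (q + 1) (sqrt (q + 1))"
proof -
  define H :: "nat \<Rightarrow> nat \<Rightarrow> int" where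
    "H i j = (if i = 0 then 1 else if j = 0 then - 1
       else leg (int j - int i) + (if i = j then 1 else 0))" for i j
  have H_abs: "\<bar>H i j\<bar> \<le> 1" if "i < q + 1" "j < q + 1" for i j
    using leg_range[of "int j - int i"] leg_square[of 0] by (auto simp: H_def)
  have leg_sum: "(\<Sum>y<q. leg (int y - int x)) = 0" for x
    using sum_leg_shift[of "- int x"] sum_nat_residues[of "\<lambda>y. leg (y - int x)"] by simp
  have split0: "(\<Sum>j<q+1. g j) = g 0 + (\<Sum>y<q. g (Suc y))" for g :: "nat \<Rightarrow> int"
    by (simp add: sum.lessThan_Suc_shift del: sum.lessThan_Suc)
  have row0: "(\<Sum>j<q+1. H (Suc x) j) = 0" if "x < q" for x
    unfolding split0 using that by (simp add: H_def sum.distrib leg_sum)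
  have leg_corr: "(\<Sum>y<q. leg (int y - int x) * leg (int y - int z)) = (if x = z then int q - 1 else - 1)"
    if "x < q" "z < q" for x z
  proof -
    have "(\<Sum>y<q. leg (int y - int x) * leg (int y - int z))
        = (\<Sum>y\<in>{0..<int q}. leg (y - int x) * leg (y - int z))"
      by (rule sum_nat_residues)
    also have "\<dots> = (\<Sum>y\<in>{0..<int q}. leg (y + int x - int x) * leg (y + int x - int z))"
    proof (rule sum_residues_bij[symmetric])
      show "leg (y mod int q - int x) * leg (y mod int q - int z) = leg (y - int x) * leg (y - int z)" for y
        by (metis leg_mod mod_diff_left_eq)
    qed (simp add: cong_add_rcancel)
    also have "\<dots> = (\<Sum>y\<in>{0..<int q}. leg y * leg (y + (int x - int z)))" by (simp add: algebra_simps)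
    also have "\<dots> = (if x = z then int q - 1 else - 1)"
    proof (cases "x = z")
      case True
      have "(\<Sum>y\<in>{0..<int q}. leg y * leg y) = (\<Sum>y\<in>{0..<int q}. if y = 0 then 0 else 1)"
        by (intro sum.cong) (auto simp: leg_square zdvd_not_zless)
      also have "\<dots> = (\<Sum>x\<in>{0..<int q} - {0}. 1)"
        using q_gt_2 by (subst sum.remove[of _ 0]) (auto intro!: sum.cong)
      also have "\<dots> = int q - 1" using q_gt_2 by (simp add: card_Diff_singleton)
      finally show ?thesis using True by simp
    next
      case False
      have "\<not> int q dvd int x - int z"
        using that False zdvd_imp_le[of "int q" "\<bar>int x - int z\<bar>"] by auto
      then show ?thesis using False leg_correlation by simp
    qed
    finally show ?thesis .
  qed
  have rows: "(\<Sum>j<q+1. H (Suc x) j * H (Suc z) j) = (if x = z then int q + 1 else 0)"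
    if "x < q" "z < q" for x z
  proof -
    have "(\<Sum>j<q+1. H (Suc x) j * H (Suc z) j) = 1 + (\<Sum>y<q. leg (int y - int x) * leg (int y - int z))
        + (\<Sum>y<q. if x = y then leg (int y - int z) else 0)
        + (\<Sum>y<q. if z = y then leg (int y - int x) else 0)
        + (\<Sum>y<q. if x = y then (if z = y then 1 else 0) else 0)"
    proof -
      have "(\<Sum>y<q. H (Suc x) (Suc y) * H (Suc z) (Suc y))
          = (\<Sum>y<q. leg (int y - int x) * leg (int y - int z) + (if x = y then leg (int y - int z) else 0)
            + (if z = y then leg (int y - int x) else 0) + (if x = y then (if z = y then 1 else 0) else 0))"
        by (intro sum.cong) (auto simp: H_def algebra_simps)
      then show ?thesis unfolding split0 by (simp add: sum.distrib H_def)
    qed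
    \<comment> \<open>For \<open>x \<noteq> z\<close> the correlation \<open>- 1\<close> cancels the
      border term, and the two remaining Legendre symbols cancel by antisymmetry.\<close>
    also have "\<dots> = (if x = z then int q + 1 else 0)"
      using that leg_uminus[of "int x - int z"] leg_uminus[of 0] by (simp add: leg_corr)
    finally show ?thesis .
  qed
  show ?thesis
  proof (rule flat_orthogonalI)
    let ?U = "\<lambda>i j. real_of_int (H i j) / sqrt (q + 1)"
    fix i k assume ik: "i < q + 1" "k < q + 1"
    have "(\<Sum>j<q+1. ?U i j * ?U k j) = (\<Sum>j<q+1. real_of_int (H i j * H k j) / (q + 1))"
      by (intro sum.cong) simp_all
    then have "(\<Sum>j<q+1. ?U i j * ?U k j) = real_of_int (\<Sum>j<q+1. H i j * H k j) / (q + 1)"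
      by (simp only: of_int_sum sum_divide_distrib)
    also have "(\<Sum>j<q+1. H i j * H k j) = (if i = k then int q + 1 else 0)"
      using ik row0 rows by (cases i; cases k) (auto simp: H_def[of 0])
    finally show "(\<Sum>j<q+1. ?U i j * ?U k j) = (if i = k then 1 else 0)" by simp
  next
    fix j show "real_of_int (H 0 j) / sqrt (q + 1) = 1 / sqrt (real (q + 1))" by (simp add: H_def)
  next
    fix i j assume "i < q + 1" "j < q + 1"
    from H_abs[OF this] show "\<bar>real_of_int (H i j) / sqrt (q + 1)\<bar> * sqrt (q + 1) \<le> 1"
      by (simp add: abs_mult)
  qed
qed

end

section \<open>Filtered Fourier matrices\<close>

text \<open>Iterating the contraction bounds \<open>F\<close> by \<open>\<rho> ^ n * C\<close>.
  Applied to differences of bounded solutions, this gives uniqueness, and thereby transfers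
  periodicity and symmetry from an equation to its solution.\<close>

lemma bounded_contraction_zero:
  fixes F :: "'b \<Rightarrow> 'a::real_normed_vector"
  assumes bound: "\<And>k. norm (F k) \<le> C" and \<rho>: "0 \<le> \<rho>" "\<rho> < 1"
    and contr: "\<And>B k. (\<And>k. norm (F k) \<le> B) \<Longrightarrow> norm (F k) \<le> \<rho> * B"
  shows "F k = 0"
proof -
  have "norm (F k) \<le> \<rho> ^ n * C" for n k
  proof (induction n arbitrary: k)
    case (Suc n)
    from contr[OF this] show ?case by (simp add: mult.assoc)
  qed (use bound in simp)
  moreover have "(\<lambda>n. \<rho> ^ n * C) \<longlonglongrightarrow> 0 * C"
    using \<rho> by (intro tendsto_mult LIMSEQ_power_zero tendsto_const) auto
  ultimately have "norm (F k) \<le> 0" using LIMSEQ_le_const[of "\<lambda>n. \<rho> ^ n * C" 0 "norm (F k)"] by simp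
  then show ?thesis by simp
qed

text \<open>Unrolling the equation along the orbit of \<open>\<sigma>\<close> gives a series with
  terms \<open>T k m\<close>, dominated by a geometric one.\<close>

lemma contraction_solution:
  fixes g r :: "'b \<Rightarrow> 'a::{banach, real_normed_field}" and \<sigma> :: "'b \<Rightarrow> 'b"
  assumes g: "\<And>k. norm (g k) \<le> D" and r: "\<And>k. norm (r k) \<le> \<rho>" and \<rho>: "0 \<le> \<rho>" "\<rho> < 1"
  shows "\<exists>F. (\<forall>k. F k = g k + r k * F (\<sigma> k)) \<and> (\<forall>k. norm (F k) \<le> D / (1 - \<rho>))"
proof -
  define T where "T k m = (\<Prod>i<m. r ((\<sigma> ^^ i) k)) * g ((\<sigma> ^^ m) k)" for k m
  have T_bound: "norm (T k m) \<le> D * \<rho> ^ m" for k m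
  proof -
    have "norm (\<Prod>i<m. r ((\<sigma> ^^ i) k)) \<le> (\<Prod>i<m. \<rho>)"
      unfolding prod_norm[symmetric] by (intro prod_mono) (simp add: r)
    then have "norm (T k m) \<le> \<rho> ^ m * D"
      unfolding T_def norm_mult using \<rho> g by (intro mult_mono) auto
    then show ?thesis by (simp add: mult.commute)
  qed
  have geo: "(\<lambda>m. D * \<rho> ^ m) sums (D * (1 / (1 - \<rho>)))"
    using \<rho> by (intro sums_mult geometric_sums) auto
  have T_summable: "summable (T k)" for k
    using T_bound geo by (intro summable_comparison_test[OF _ sums_summable[OF geo]]) auto
  define F where "F k = (\<Sum>m. T k m)" for k
  have "F k = g k + r k * F (\<sigma> k)" for k
  proof -
    have "F k = T k 0 + (\<Sum>m. T k (Suc m))"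
      unfolding F_def using suminf_split_head[OF T_summable] by (simp add: algebra_simps)
    also have "(\<lambda>m. T k (Suc m)) = (\<lambda>m. r k * T (\<sigma> k) m)"
      by (rule ext) (simp add: T_def prod.lessThan_Suc_shift funpow_swap1 mult.assoc del: prod.lessThan_Suc)
    also have "(\<Sum>m. r k * T (\<sigma> k) m) = r k * F (\<sigma> k)"
      unfolding F_def by (rule suminf_mult[OF T_summable])
    finally show ?thesis by (simp add: T_def)
  qed
  moreover have "norm (F k) \<le> D / (1 - \<rho>)" for k
  proof -
    have "norm (F k) \<le> (\<Sum>m. D * \<rho> ^ m)"
      unfolding F_def by (rule norm_suminf_le[OF T_bound sums_summable[OF geo]])
    also have "\<dots> = D / (1 - \<rho>)" using sums_unique[OF geo] by simp
    finally show ?thesis .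
  qed
  ultimately show ?thesis by blast
qed

section \<open>Characters and the all-pass filter\<close>

text \<open>A character of the cyclic group of order \<open>M\<close>. The frequency is an unreduced
  integer, so that negation and multiplication act on it directly.\<close>

definition char_fun :: "nat \<Rightarrow> int \<Rightarrow> nat \<Rightarrow> complex" where
  "char_fun M k j = cis (2 * pi * real_of_int k * real j / real M)"

lemma cis_add_2pi_int: "cis (x + 2 * pi * real_of_int n) = cis x"
  by (simp add: cis_mult[symmetric] cis_multiple_2pi)

lemma char_fun_cong:
  assumes "M > 0" "[k = l] (mod int M)"
  shows "char_fun M k j = char_fun M l j"
proof -
  obtain t where "k = l + int M * t" using assms(2) by (metis cong_iff_lin cong_sym)
  then have "2 * pi * real_of_int k * real j / real M
      = 2 * pi * real_of_int l * real j / real M + 2 * pi * real_of_int (t * int j)"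
    using assms(1) by (simp add: field_simps)
  then show ?thesis unfolding char_fun_def by (metis cis_add_2pi_int)
qed

lemma char_fun_uminus: "char_fun M (- k) j = cnj (char_fun M k j)"
  by (simp add: char_fun_def cis_cnj)

lemma norm_char_fun: "norm (char_fun M k j) = 1"
  by (simp add: char_fun_def)

text \<open>A geometric sum over powers of an \<open>M\<close>-th root of unity \<open>z\<close>,
  which equals 1 only for congruent frequencies.\<close>

lemma char_fun_orthogonal:
  assumes M: "M > 0"
  shows "(\<Sum>j<M. char_fun M k j * cnj (char_fun M l j)) = (if [k = l] (mod int M) then of_nat M else 0)"
proof -
  define z where "z = cis (2 * pi * real_of_int (k - l) / real M)"
  have zj: "char_fun M k j * cnj (char_fun M l j) = z ^ j" for j
  proof -
    have "char_fun M k j * cnj (char_fun M l j)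
        = cis (2 * pi * real_of_int k * real j / real M + - (2 * pi * real_of_int l * real j / real M))"
      by (simp only: char_fun_def cis_cnj cis_mult)
    also have "2 * pi * real_of_int k * real j / real M + - (2 * pi * real_of_int l * real j / real M)
        = real j * (2 * pi * real_of_int (k - l) / real M)"
      by (simp add: algebra_simps diff_divide_distrib)
    finally show ?thesis unfolding z_def Complex.DeMoivre .
  qed
  show ?thesis
  proof (cases "[k = l] (mod int M)")
    case True
    then have "char_fun M k j * cnj (char_fun M l j) = 1" for j
      using char_fun_cong[OF M True] by (simp add: char_fun_def cis_cnj cis_mult)
    then show ?thesis using True by simp
  next
    case False
    have "z ^ M = cis (real M * (2 * pi * real_of_int (k - l) / real M))"
      by (simp only: z_def Complex.DeMoivre)
    also have "real M * (2 * pi * real_of_int (k - l) / real M) = 0 + 2 * pi * real_of_int (k - l)"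
      using M by simp
    finally have "z ^ M = 1" unfolding cis_add_2pi_int by simp
    moreover have "z \<noteq> 1"
    proof
      assume "z = 1"
      then have "cos (2 * pi * real_of_int (k - l) / real M) = 1" by (metis z_def cis.simps(1) one_complex.simps(1))
      then obtain n :: int where "2 * pi * real_of_int (k - l) / real M = real_of_int n * 2 * pi"
        unfolding cos_one_2pi_int by blast
      then have "2 * pi * real_of_int (k - l) = 2 * pi * real_of_int (n * int M)"
        using M by (simp add: field_simps)
      then have "real_of_int (k - l) = real_of_int (n * int M)"
        by (rule mult_left_cancel[THEN iffD1, rotated]) simp
      then have "k - l = n * int M" unfolding of_int_eq_iff .
      then have "[k = l] (mod int M)" by (simp add: cong_iff_dvd_diff)
      then show False using False by simp
    qed
    ultimately have "(\<Sum>j<M. z ^ j) = 0" using geometric_sum[of z M] by simp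
    then show ?thesis using False by (simp add: zj)
  qed
qed

text \<open>With \<open>S e\<^sub>k = w\<^sub>k e\<^bsub>q k\<^esub>\<close>, the functions \<open>B\<^sub>k = (1 - a S\<^sup>-\<^sup>1)\<^sup>-\<^sup>1 e\<^sub>k\<close> are obtained from their
  fixed-point equation. Their inner products \<open>X\<close> and the inner products \<open>Y\<close> of the \<open>S B\<^sub>k\<close> solve the
  same contractive system, hence agree, and this makes \<open>B\<^sub>k - a S B\<^sub>k\<close> orthogonal.\<close>

lemma all_pass_rows:
  fixes M :: nat and p q :: int and w u :: "int \<Rightarrow> complex" and a :: real
  assumes M: "M > 0" and pq: "[p * q = 1] (mod int M)" and q: "odd q"
    and w: "\<And>k. norm (w k) = 1" "\<And>k l. [k = l] (mod int M) \<Longrightarrow> w k = w l" "\<And>k. w (- k) = cnj (w k)"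
    and u: "\<And>k. norm (u k) = 1" "\<And>k l. [k = l] (mod int M) \<Longrightarrow> u k = u l" "\<And>k. u (- k) = cnj (u k)"
    and a: "0 \<le> a" "2 * a + a\<^sup>2 < 1"
  defines "e \<equiv> char_fun M"
  shows "\<exists>G :: int \<Rightarrow> nat \<Rightarrow> complex.
     (\<forall>k l. (\<Sum>j<M. G k j * cnj (G l j)) = (if [k = l] (mod int M) then of_nat M else 0)) \<and>
     (\<forall>k j. G (- k) j = cnj (G k j)) \<and>
     (\<forall>k j. norm (G k j - u k * (of_real (1 - a\<^sup>2) * (e k j + of_real a * cnj (w (p * k)) * e (p * k) j)
        - of_real a * w k * e (q * k) j)) \<le> a\<^sup>2 * (1 + a)) \<and>
     (\<forall>k j. [2 * k = 0] (mod int M) \<longrightarrow> G k j = u k * e k j)"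
proof -
  have a1: "a < 1" using a by (smt (verit) zero_le_power2)
  have w_cnj: "w k * cnj (w k) = 1" "cnj (w k) * w k = 1" for k
    using w(1)[of k] by (simp_all add: complex_norm_square[symmetric] mult.commute)
  have u_cnj: "u k * cnj (u k) = 1" for k
    using u(1)[of k] by (simp add: complex_norm_square[symmetric])
  \<comment> \<open>The coefficient of \<open>S\<^sup>-\<^sup>1\<close>, which maps frequency
    \<open>k\<close> to \<open>p * k\<close>.\<close>
  define c where "c k = cnj (w (p * k))" for k
  have c1: "norm (c k) = 1" for k by (simp add: c_def w)
  have "\<exists>F. (\<forall>k. F k = e k j + (of_real a * c k) * F (p * k)) \<and> (\<forall>k. norm (F k) \<le> 1 / (1 - a))" for j
    by (rule contraction_solution) (use a a1 c1 in \<open>auto simp: e_def norm_char_fun norm_mult\<close>)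
  then obtain B' where B': "\<And>j k. B' j k = e k j + of_real a * c k * B' j (p * k)"
      "\<And>j k. norm (B' j k) \<le> 1 / (1 - a)" by metis
  define B where "B k j = B' j k" for k j
  have B: "B k j = e k j + of_real a * c k * B (p * k) j" and B_norm: "norm (B k j) \<le> 1 / (1 - a)" for k j
    using B'(1)[of j k] B'(2)[of j k] by (simp_all add: B_def)
  have pqk: "[p * (q * k) = k] (mod int M)" "[q * (p * k) = k] (mod int M)" for k
    using cong_scalar_right[OF pq, of k] by (simp_all add: algebra_simps)
  \<comment> \<open>The solution is defined on all integers. The difference of its values at two
    representatives satisfies the homogeneous equation, hence vanishes.\<close>
  have B_cong: "B k j = B l j" if kl: "[k = l] (mod int M)" for k l j
  proof -
    define F where "F = (\<lambda>(k, t). B (k + int M * t) j - B k j)"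
    have "F x = 0" for x
    proof (rule bounded_contraction_zero[where F = F and C = "2 / (1 - a)" and \<rho> = a])
      show "norm (F x) \<le> 2 / (1 - a)" for x
        using B_norm[of "fst x + int M * snd x" j] B_norm[of "fst x" j]
          norm_triangle_ineq4[of "B (fst x + int M * snd x) j" "B (fst x) j"]
        by (simp add: F_def case_prod_unfold)
      show "norm (F x) \<le> a * C" if C: "\<And>x. norm (F x) \<le> C" for C x
      proof -
        obtain k t where x: "x = (k, t)" by (cases x)
        have "c (k + int M * t) = c k"
          unfolding c_def by (rule arg_cong[OF w(2)]) (simp add: cong_iff_dvd_diff algebra_simps)
        moreover have "e (k + int M * t) j = e k j"
          unfolding e_def by (rule char_fun_cong[OF M]) (simp add: cong_iff_dvd_diff)
        ultimately have "F x = of_real a * c k * F (p * k, p * t)"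
          using B[of "k + int M * t" j] B[of k j] by (simp add: x F_def algebra_simps)
        then show ?thesis using C[of "(p * k, p * t)"] a by (simp add: norm_mult c1 mult_left_mono)
      qed
    qed (use a a1 in auto)
    moreover obtain t where "k = l + int M * t" using kl by (metis cong_iff_lin cong_sym)
    ultimately have "F (l, t) = 0" "k = l + int M * t" by auto
    then show ?thesis by (simp add: F_def)
  qed
  have B_uminus: "B (- k) j = cnj (B k j)" for k j
  proof -
    define F where "F k = B (- k) j - cnj (B k j)" for k
    have "F k = 0"
    proof (rule bounded_contraction_zero[where F = F and C = "2 / (1 - a)" and \<rho> = a])
      show "norm (F k) \<le> 2 / (1 - a)" for k
        using B_norm[of "- k" j] B_norm[of k j] norm_triangle_ineq4[of "B (- k) j" "cnj (B k j)"]
        by (simp add: F_def)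
      show "norm (F k) \<le> a * C" if C: "\<And>k. norm (F k) \<le> C" for C k
      proof -
        have "c (- k) = cnj (c k)" using w(3)[of "p * k"] by (simp add: c_def)
        then have "F k = of_real a * cnj (c k) * F (p * k)"
          using B[of "- k" j] B[of k j] char_fun_uminus[of M k j]
          by (simp add: F_def e_def algebra_simps)
        then show ?thesis using C[of "p * k"] a by (simp add: norm_mult c1 mult_left_mono)
      qed
    qed (use a a1 in auto)
    then show ?thesis by (simp add: F_def)
  qed
  \<comment> \<open>The left-hand side is \<open>S B\<^sub>k\<close>; the fixed-point equation at
    \<open>q * k\<close> reduces it to a character and \<open>B k\<close>.\<close>
  have wB: "w k * B (q * k) j = w k * e (q * k) j + of_real a * B k j" for k j
  proof -
    have "c (q * k) = cnj (w k)" unfolding c_def by (rule arg_cong[OF w(2)]) (rule pqk)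
    then have "B (q * k) j = e (q * k) j + of_real a * cnj (w k) * B k j"
      using B[of "q * k" j] B_cong[OF pqk(1)] by simp
    then have "w k * B (q * k) j = w k * e (q * k) j + of_real a * (w k * cnj (w k)) * B k j"
      by (simp add: algebra_simps)
    then show ?thesis by (simp add: w_cnj)
  qed
  define X where "X k l = (\<Sum>j<M. B k j * cnj (B l j))" for k l
  define \<delta> where "\<delta> k l = (if [k = l] (mod int M) then of_nat M else 0 :: complex)" for k l
  have X_cong: "X k l = X k' l'" if "[k = k'] (mod int M)" "[l = l'] (mod int M)" for k k' l l'
    unfolding X_def using B_cong[OF that(1)] B_cong[OF that(2)] by simp
  have \<delta>_w: "w k * cnj (w l) * \<delta> k l = \<delta> k l" for k l
    using w(2)[of k l] by (auto simp: \<delta>_def w_cnj)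
  have \<delta>_q: "\<delta> (q * k) (q * l) = \<delta> k l" for k l
  proof -
    have "[q * k = q * l] (mod int M) \<longleftrightarrow> [k = l] (mod int M)"
      using pqk(1) by (metis cong_scalar_left cong_sym cong_trans)
    then show ?thesis by (simp add: \<delta>_def)
  qed
  have X_rec: "X k l = \<delta> k l + of_real a * c k * X (p * k) l + of_real a * cnj (c l) * X k (p * l)
      - of_real (a\<^sup>2) * (c k * cnj (c l)) * X (p * k) (p * l)" for k l
  proof -
    have "\<delta> k l = (\<Sum>j<M. e k j * cnj (e l j))"
      unfolding \<delta>_def e_def by (rule char_fun_orthogonal[OF M, symmetric])
    also have "\<dots> = (\<Sum>j<M. (B k j - of_real a * c k * B (p * k) j) * cnj (B l j - of_real a * c l * B (p * l) j))"
      using B by (intro sum.cong refl) (metis add_diff_cancel_right')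
    also have "\<dots> = X k l - of_real a * c k * X (p * k) l - of_real a * cnj (c l) * X k (p * l)
      + of_real (a\<^sup>2) * (c k * cnj (c l)) * X (p * k) (p * l)"
      by (simp add: X_def sum_subtractf sum.distrib sum_distrib_left algebra_simps power2_eq_square)
    finally show ?thesis by (simp add: algebra_simps)
  qed
  define Y where "Y k l = w k * cnj (w l) * X (q * k) (q * l)" for k l
  have Y_eq: "Y k l = \<delta> k l + of_real a * cnj (w l) * X k (q * l) + of_real a * w k * X (q * k) l
      - of_real (a\<^sup>2) * X k l" for k l
  proof -
    have cq: "c (q * k) = cnj (w k)" for k unfolding c_def by (rule arg_cong[OF w(2)]) (rule pqk)
    have "Y k l = w k * cnj (w l) * \<delta> k l + of_real a * cnj (w l) * (w k * cnj (w k)) * X (p * (q * k)) (q * l)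
        + of_real a * w k * (w l * cnj (w l)) * X (q * k) (p * (q * l))
        - of_real (a\<^sup>2) * ((w k * cnj (w k)) * (w l * cnj (w l))) * X (p * (q * k)) (p * (q * l))"
      unfolding Y_def X_rec[of "q * k" "q * l"] cq \<delta>_q by (simp add: algebra_simps)
    also have "X (p * (q * k)) (q * l) = X k (q * l)" by (rule X_cong) (rule pqk cong_refl)+
    also have "X (q * k) (p * (q * l)) = X (q * k) l" by (rule X_cong) (rule pqk cong_refl)+
    also have "X (p * (q * k)) (p * (q * l)) = X k l" by (rule X_cong) (rule pqk)+
    finally show ?thesis by (simp add: w_cnj \<delta>_w)
  qed
  have Y_shift: "cnj (w l) * X k (q * l) = c k * Y (p * k) l"
      "w k * X (q * k) l = cnj (c l) * Y k (p * l)"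
      "X k l = c k * cnj (c l) * Y (p * k) (p * l)" for k l
  proof -
    have 1: "X (q * (p * k)) l' = X k l'" "X l' (q * (p * k)) = X l' k" for k l'
      by (rule X_cong; rule pqk cong_refl)+
    have 2: "c k * w (p * k) = 1" "cnj (c k) * cnj (w (p * k)) = 1" for k by (simp_all add: c_def w_cnj)
    have "c k * Y (p * k) l = (c k * w (p * k)) * (cnj (w l) * X (q * (p * k)) (q * l))"
      by (simp add: Y_def algebra_simps)
    then show "cnj (w l) * X k (q * l) = c k * Y (p * k) l" unfolding 1 2 by simp
    have "cnj (c l) * Y k (p * l) = (cnj (c l) * cnj (w (p * l))) * (w k * X (q * k) (q * (p * l)))"
      by (simp add: Y_def algebra_simps)
    then show "w k * X (q * k) l = cnj (c l) * Y k (p * l)" unfolding 1 2 by simp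
    have "c k * cnj (c l) * Y (p * k) (p * l)
        = (c k * w (p * k)) * (cnj (c l) * cnj (w (p * l))) * X (q * (p * k)) (q * (p * l))"
      by (simp add: Y_def algebra_simps)
    then show "X k l = c k * cnj (c l) * Y (p * k) (p * l)" unfolding 1 2 by simp
  qed
  have XY: "X k l = Y k l" for k l
  proof -
    define D where "D = (\<lambda>(k, l). X k l - Y k l)"
    have Y_rec: "Y k l = \<delta> k l + of_real a * c k * Y (p * k) l + of_real a * cnj (c l) * Y k (p * l)
      - of_real (a\<^sup>2) * (c k * cnj (c l)) * Y (p * k) (p * l)" for k l
      using Y_eq[of k l] Y_shift[of l k] Y_shift[of k l] by (simp add: mult.assoc)
    define C where "C = real M * (1 / (1 - a) * (1 / (1 - a)))"
    have X_norm: "norm (X k l) \<le> C" for k l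
    proof -
      have "norm (B k j * cnj (B l j)) \<le> 1 / (1 - a) * (1 / (1 - a))" for j
        using B_norm[of k j] B_norm[of l j] a1 unfolding norm_mult complex_mod_cnj
        by (intro mult_mono) auto
      then have "norm (X k l) \<le> (\<Sum>j<M. 1 / (1 - a) * (1 / (1 - a)))"
        unfolding X_def by (intro order_trans[OF norm_sum] sum_mono)
      then show ?thesis by (simp add: C_def)
    qed
    \<comment> \<open>The recursion shared by \<open>X\<close> and \<open>Y\<close> has coefficients
      of modulus \<open>a\<close>, \<open>a\<close> and \<open>a\<^sup>2\<close>, whose sum is less
      than 1.\<close>
    have "D x = 0" for x
    proof (rule bounded_contraction_zero[where F = D and C = "C + C" and \<rho> = "2 * a + a\<^sup>2"])
      show "norm (D x) \<le> C + C" for x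
      proof -
        have "norm (X (fst x) (snd x) - Y (fst x) (snd x)) \<le> norm (X (fst x) (snd x)) + norm (Y (fst x) (snd x))"
          by (rule norm_triangle_ineq4)
        also have "\<dots> \<le> C + C"
          using X_norm by (intro add_mono) (auto simp: Y_def norm_mult w)
        finally show ?thesis by (simp add: D_def case_prod_unfold)
      qed
      show "norm (D x) \<le> (2 * a + a\<^sup>2) * C'" if C': "\<And>x. norm (D x) \<le> C'" for C' x
      proof -
        obtain k l where x: "x = (k, l)" by (cases x)
        have "D x = of_real a * c k * D (p * k, l) + of_real a * cnj (c l) * D (k, p * l)
            - of_real (a\<^sup>2) * (c k * cnj (c l)) * D (p * k, p * l)"
          unfolding x D_def case_prod_conv by (subst X_rec, subst Y_rec) (simp add: algebra_simps)
        also have "norm \<dots> \<le> a * C' + a * C' + a\<^sup>2 * C'"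
          using C' a by (intro order_trans[OF norm_triangle_ineq4] order_trans[OF norm_triangle_ineq] add_mono)
            (auto simp: norm_mult c1 norm_power intro!: mult_left_mono)
        finally show ?thesis by (simp add: algebra_simps)
      qed
    qed (use a in auto)
    then have "D (k, l) = 0" .
    then show ?thesis by (simp add: D_def)
  qed
  define G where "G k j = u k * (B k j - of_real a * w k * B (q * k) j)" for k j
  show ?thesis
  proof (intro exI[of _ G] conjI allI impI)
    fix k l
    have "(\<Sum>j<M. G k j * cnj (G l j)) = u k * cnj (u l) * (X k l - of_real a * w k * X (q * k) l
        - of_real a * cnj (w l) * X k (q * l) + of_real (a\<^sup>2) * Y k l)"
      by (simp add: G_def X_def Y_def sum_subtractf sum.distrib sum_distrib_left algebra_simps power2_eq_square)
    also have "\<dots> = u k * cnj (u l) * \<delta> k l"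
    proof -
      \<comment> \<open>With \<open>Y = X\<close>, the equation \<open>Y_eq\<close> says that the
        bracket equals \<open>\<delta> k l\<close>.\<close>
      have lin: "x - a - b + c = d" if "x = d + b + a - c" for x a b c d :: complex
        using that by simp
      show ?thesis unfolding XY[symmetric] using lin[OF Y_eq[of k l, folded XY]] by simp
    qed
    also have "\<dots> = \<delta> k l" using u(2)[of k l] by (auto simp: \<delta>_def u_cnj)
    finally show "(\<Sum>j<M. G k j * cnj (G l j)) = (if [k = l] (mod int M) then of_nat M else 0)"
      by (simp add: \<delta>_def)
  next
    fix k j show "G (- k) j = cnj (G k j)"
      using B_uminus[of k j] B_uminus[of "q * k" j] by (simp add: G_def u w)
  next
    fix k j
    \<comment> \<open>Two unrollings leave a remainder of second order in \<open>a\<close>. Its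
      bound uses \<open>(1 - a\<^sup>2) / (1 - a) = 1 + a\<close>.\<close>
    have BB: "B k j = e k j + of_real a * c k * (e (p * k) j + of_real a * c (p * k) * B (p * (p * k)) j)"
      using B[of k j] B[of "p * k" j] by simp
    have "G k j = u k * (of_real (1 - a\<^sup>2) * B k j - of_real a * w k * e (q * k) j)"
      unfolding G_def mult.assoc wB by (simp add: algebra_simps power2_eq_square)
    then have "G k j - u k * (of_real (1 - a\<^sup>2) * (e k j + of_real a * cnj (w (p * k)) * e (p * k) j)
        - of_real a * w k * e (q * k) j)
      = u k * of_real (1 - a\<^sup>2) * of_real (a\<^sup>2) * c k * c (p * k) * B (p * (p * k)) j"
      unfolding BB by (simp add: c_def algebra_simps power2_eq_square)
    also have "norm \<dots> = (1 - a\<^sup>2) * a\<^sup>2 * norm (B (p * (p * k)) j)"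
    proof -
      have "a\<^sup>2 \<le> 1" using a a1 by (simp add: power_le_one)
      then have n: "norm (complex_of_real (1 - a\<^sup>2)) = 1 - a\<^sup>2" "norm (complex_of_real (a\<^sup>2)) = a\<^sup>2"
        by (simp_all only: norm_of_real) simp_all
      show ?thesis unfolding norm_mult u c1 n by simp
    qed
    also have "\<dots> \<le> (1 - a\<^sup>2) * a\<^sup>2 * (1 / (1 - a))"
      using B_norm a a1 by (intro mult_left_mono) (auto simp: power_le_one)
    also have "\<dots> = a\<^sup>2 * (1 + a)"
      using a1 by (simp add: field_simps power2_eq_square)
    finally show "norm (G k j - u k * (of_real (1 - a\<^sup>2) * (e k j + of_real a * cnj (w (p * k)) * e (p * k) j)
        - of_real a * w k * e (q * k) j)) \<le> a\<^sup>2 * (1 + a)" .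
  next
    fix k j assume k: "[2 * k = 0] (mod int M)"
    \<comment> \<open>A self-conjugate frequency is fixed by the odd \<open>q\<close>, and
      \<open>w k\<close> is real there, so the two factors of the filter cancel.\<close>
    obtain r where r: "q = 2 * r + 1" using q by (elim oddE)
    have qk: "[q * k = k] (mod int M)"
      using cong_add[OF cong_scalar_left[OF k, of r] cong_refl[of k]] by (simp add: r algebra_simps)
    have pk: "[p * k = k] (mod int M)"
      using cong_trans[OF cong_scalar_left[OF cong_sym[OF qk]] pqk(1)] .
    have "[- k = k] (mod int M)" using k by (simp add: cong_iff_dvd_diff)
    then have "w k = cnj (w k)" using w(2,3) by metis
    then have ck: "c k = w k" using w(2)[OF pk] by (simp add: c_def)
    have "B k j - of_real a * w k * B k j = e k j"
      using B[of k j] unfolding B_cong[OF pk] ck by (simp add: algebra_simps)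
    then show "G k j = u k * e k j" unfolding G_def B_cong[OF qk] by simp
  qed
qed

text \<open>The Hartley transform trick: the rows \<open>Re G\<^sub>k + Im G\<^sub>k\<close> of a conjugation-symmetric
  orthogonal system of complex rows are orthogonal.\<close>

lemma flat_orthogonal_hartley:
  fixes G :: "int \<Rightarrow> nat \<Rightarrow> complex"
  assumes M: "M > 0"
    and orth: "\<And>k l. (\<Sum>j<M. G k j * cnj (G l j)) = (if [k = l] (mod int M) then of_nat M else 0)"
    and cnj_G: "\<And>k j. G (- k) j = cnj (G k j)" and G0: "\<And>j. G 0 j = 1"
    and bound: "\<And>k j. \<bar>Re (G k j) + Im (G k j)\<bar> * f \<le> sqrt M"
  shows "flat_orthogonal M f"
proof (rule flat_orthogonalI)
  let ?U = "\<lambda>i j. (Re (G (int i) j) + Im (G (int i) j)) / sqrt M"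
  fix i k assume ik: "i < M" "k < M"
  have "(Re (G (int i) j) + Im (G (int i) j)) * (Re (G (int k) j) + Im (G (int k) j))
      = Re (G (int i) j * cnj (G (int k) j)) + Im (G (int i) j * cnj (G (- int k) j))" for j
    by (simp add: cnj_G algebra_simps)
  then have "(\<Sum>j<M. ?U i j * ?U k j)
      = (\<Sum>j<M. (Re (G (int i) j * cnj (G (int k) j)) + Im (G (int i) j * cnj (G (- int k) j))) / M)"
    by (intro sum.cong) simp_all
  also have "\<dots> = (Re (\<Sum>j<M. G (int i) j * cnj (G (int k) j))
      + Im (\<Sum>j<M. G (int i) j * cnj (G (- int k) j))) / M"
    by (simp only: Re_sum Im_sum sum.distrib add_divide_distrib sum_divide_distrib)
  \<comment> \<open>The inner products in \<open>orth\<close> are real, so the imaginary part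
    contributes nothing.\<close>
  also have "\<dots> = (if [int i = int k] (mod int M) then 1 else 0)"
    unfolding orth using M by simp
  also have "[int i = int k] (mod int M) \<longleftrightarrow> i = k"
    using ik by (simp add: cong_int_iff cong_def)
  finally show "(\<Sum>j<M. ?U i j * ?U k j) = (if i = k then 1 else 0)" .
next
  fix j show "(Re (G (int 0) j) + Im (G (int 0) j)) / sqrt M = 1 / sqrt M" by (simp add: G0)
next
  fix i j
  show "\<bar>(Re (G (int i) j) + Im (G (int i) j)) / sqrt M\<bar> * f \<le> 1"
    using bound[of "int i" j] M by (simp add: field_simps)
qed

text \<open>The unfiltered Hartley matrix: \<open>Re z + Im z\<close> is at most
  \<open>sqrt 2\<close> in absolute value on the unit circle.\<close>

lemma flat_orthogonal_trivial:
  assumes M: "M > 0"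
  shows "flat_orthogonal M (sqrt (M / 2))"
proof (rule flat_orthogonal_hartley[OF M char_fun_orthogonal[OF M] char_fun_uminus])
  fix k j
  show "char_fun M 0 j = 1" by (simp add: char_fun_def)
  have "\<bar>Re z + Im z\<bar> \<le> sqrt 2" if "norm z = 1" for z
  proof -
    have "(Re z + Im z)\<^sup>2 \<le> 2 * ((Re z)\<^sup>2 + (Im z)\<^sup>2)"
      using zero_le_power2[of "Re z - Im z"] by (simp add: power2_eq_square algebra_simps)
    also have "\<dots> = 2" using that cmod_power2[of z] by simp
    finally show ?thesis using real_le_rsqrt[of "\<bar>Re z + Im z\<bar>" 2] by simp
  qed
  then have "\<bar>Re (char_fun M k j) + Im (char_fun M k j)\<bar> * sqrt (M / 2) \<le> sqrt 2 * sqrt (M / 2)"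
    by (intro mult_right_mono) (simp_all add: norm_char_fun)
  then show "\<bar>Re (char_fun M k j) + Im (char_fun M k j)\<bar> * sqrt (M / 2) \<le> sqrt M"
    by (simp flip: real_sqrt_mult)
qed

lemma cos_minus_odd_pi:
  assumes "odd n"
  shows "cos (x - pi * real_of_int n) = - cos x"
proof -
  obtain m where "n = 2 * m + 1" using assms by (elim oddE)
  then have "x - pi * real_of_int n = (x - pi) + 2 * pi * real_of_int (- m)" by (simp add: algebra_simps)
  then have "cis (x - pi * real_of_int n) = cis (x - pi)" by (simp only: cis_add_2pi_int)
  then have "cos (x - pi * real_of_int n) = cos (x - pi)" by (metis cis.simps(1))
  then show ?thesis by simp
qed

text \<open>\<open>A\<close> is the bounded solution of the contraction \<open>A k = (A (q k) - \<pi> s k) / q\<close>. It is odd because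
  \<open>s k\<close> is taken to be the sign of the representative of \<open>k\<close> of least absolute value.\<close>

lemma phase_function:
  fixes M :: nat and q :: int
  assumes M: "M > 0" and q: "\<bar>q\<bar> \<ge> 2"
  shows "\<exists>A :: int \<Rightarrow> real. (\<forall>k l. [k = l] (mod int M) \<longrightarrow> A k = A l) \<and> (\<forall>k. A (- k) = - A k) \<and>
    (\<forall>k. \<not> [2 * k = 0] (mod int M) \<longrightarrow> (\<exists>s. odd s \<and> A (q * k) = real_of_int q * A k + pi * real_of_int s))"
proof -
  \<comment> \<open>The value 0 at the residues 0 and \<open>M / 2\<close>, which equal their own
    negatives, keeps \<open>s\<close> an odd function.\<close>
  define s where "s k = (let x = k mod int M in if x = 0 \<or> 2 * x = int M then 0 else if 2 * x < int M then 1 else - 1 :: int)" for k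
  have s_cong: "s k = s l" if "[k = l] (mod int M)" for k l
    using that by (simp add: s_def cong_def)
  have s_uminus: "s (- k) = - s k" for k
  proof -
    have "0 \<le> k mod int M" "k mod int M < int M" using M by simp_all
    then show ?thesis by (auto simp: s_def Let_def zmod_zminus1_eq_if)
  qed
  have s_abs: "\<bar>real_of_int (s k)\<bar> \<le> 1" for k by (simp add: s_def Let_def)
  have s_odd: "odd (s k)" if "\<not> [2 * k = 0] (mod int M)" for k
  proof -
    have "[2 * k = 0] (mod int M)" if "k mod int M = 0 \<or> 2 * (k mod int M) = int M"
    proof -
      have "2 * k mod int M = 2 * (k mod int M) mod int M" by (simp add: mod_mult_right_eq)
      then show ?thesis using that by (auto simp: cong_def)
    qed
    then show ?thesis using that by (auto simp: s_def Let_def)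
  qed
  define \<rho> where "\<rho> = 1 / \<bar>real_of_int q\<bar>"
  have \<rho>: "0 \<le> \<rho>" "\<rho> < 1" using q by (auto simp: \<rho>_def)
  have q0: "real_of_int q \<noteq> 0" using q by auto
  have "\<exists>A. (\<forall>k. A k = - pi * s k / q + 1 / q * A (q * k)) \<and> (\<forall>k. norm (A k) \<le> pi / (1 - \<rho>))"
  proof (rule contraction_solution)
    show "norm (- pi * s k / q) \<le> pi" for k
    proof -
      have "norm (- pi * s k / q) = pi * (\<bar>real_of_int (s k)\<bar> * \<rho>)" by (simp add: \<rho>_def abs_mult)
      also have "\<dots> \<le> pi * (1 * 1)" using s_abs \<rho> by (intro mult_left_mono mult_mono) auto
      finally show ?thesis by simp
    qed
  qed (use \<rho> in \<open>auto simp: \<rho>_def\<close>)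
  then obtain A where A: "\<And>k. A k = - pi * s k / q + 1 / q * A (q * k)" and A_norm: "\<And>k. norm (A k) \<le> pi / (1 - \<rho>)"
    by blast
  have A_cong: "A k = A l" if kl: "[k = l] (mod int M)" for k l
  proof -
    define F where "F = (\<lambda>(k, t). A (k + int M * t) - A k)"
    have "F x = 0" for x
    proof (rule bounded_contraction_zero[where F = F and C = "pi / (1 - \<rho>) + pi / (1 - \<rho>)" and \<rho> = \<rho>])
      show "norm (F x) \<le> pi / (1 - \<rho>) + pi / (1 - \<rho>)" for x
        unfolding F_def case_prod_unfold by (rule order_trans[OF norm_triangle_ineq4 add_mono[OF A_norm A_norm]])
      show "norm (F x) \<le> \<rho> * C" if C: "\<And>x. norm (F x) \<le> C" for C x
      proof -
        obtain k t where x: "x = (k, t)" by (cases x)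
        have "s (k + int M * t) = s k" by (rule s_cong) (simp add: cong_iff_dvd_diff)
        then have "F x = 1 / q * F (q * k, q * t)"
          using A[of "k + int M * t"] A[of k] by (simp add: x F_def algebra_simps diff_divide_distrib)
        then have "norm (F x) = \<rho> * norm (F (q * k, q * t))" by (simp add: \<rho>_def)
        then show ?thesis using C[of "(q * k, q * t)"] \<rho> by (simp add: mult_left_mono)
      qed
    qed (use \<rho> in auto)
    moreover obtain t where "k = l + int M * t" using kl by (metis cong_iff_lin cong_sym)
    ultimately have "F (l, t) = 0" "k = l + int M * t" by auto
    then show ?thesis by (simp add: F_def)
  qed
  have A_uminus: "A (- k) = - A k" for k
  proof -
    define F where "F k = A (- k) + A k" for k
    have "F k = 0"
    proof (rule bounded_contraction_zero[where F = F and C = "pi / (1 - \<rho>) + pi / (1 - \<rho>)" and \<rho> = \<rho>])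
      show "norm (F k) \<le> pi / (1 - \<rho>) + pi / (1 - \<rho>)" for k
        unfolding F_def by (rule order_trans[OF norm_triangle_ineq add_mono[OF A_norm A_norm]])
      show "norm (F k) \<le> \<rho> * C" if C: "\<And>k. norm (F k) \<le> C" for C k
      proof -
        have "F k = 1 / q * F (q * k)"
          using A[of "- k"] A[of k] by (simp add: F_def s_uminus algebra_simps add_divide_distrib)
        then have "norm (F k) = \<rho> * norm (F (q * k))" by (simp add: \<rho>_def)
        then show ?thesis using C[of "q * k"] \<rho> by (simp add: mult_left_mono)
      qed
    qed (use \<rho> in auto)
    then show ?thesis by (simp add: F_def)
  qed
  have "A (q * k) = real_of_int q * A k + pi * real_of_int (s k)" for k
    using A[of k] q0 by (simp add: field_simps)
  then show ?thesis using A_cong A_uminus s_odd by blast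
qed

text \<open>With \<open>v\<^sub>k = cis (b k - \<pi>/4)\<close> and \<open>\<theta> = arg (v\<^sub>k e\<^sub>k)\<close>, the phases \<open>w\<^sub>k = v\<^sub>k\<^bsup>q-1\<^esup>\<close> turn the
  outgoing term of the filter into \<open>cos (q \<theta>)\<close>; the functional equation of \<open>A = (q - 1) b\<close> makes
  the incoming angle \<open>y\<close> satisfy \<open>\<theta> = q y + \<pi>\<close> up to full turns.\<close>

lemma flat_orthogonal_fourier:
  fixes M :: nat and q r :: int and a \<kappa> :: real
  assumes M: "M > 0" and cop: "coprime q (int M)" and qr: "q = 4 * r + 1" "r \<noteq> 0"
    and a: "0 \<le> a" "2 * a + a\<^sup>2 < 1" and \<kappa>: "\<kappa> \<ge> 3/4"
    and sup: "\<And>y. \<bar>a * cos (real_of_int q * (real_of_int q * y)) + (1 - a\<^sup>2) * (a * cos y - cos (real_of_int q * y))\<bar> \<le> \<kappa> - a\<^sup>2 * (1 + a)"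
  shows "flat_orthogonal M (sqrt (M / 2) / \<kappa>)"
proof -
  have q: "odd q" "\<bar>q\<bar> \<ge> 2" "q \<noteq> 1" using qr by auto
  obtain p where "[q * p = 1] (mod int M)" using cong_solve_coprime_int[OF cop] by auto
  then have pq: "[p * q = 1] (mod int M)" by (simp add: mult.commute)
  obtain A :: "int \<Rightarrow> real" where A: "\<And>k l. [k = l] (mod int M) \<Longrightarrow> A k = A l" "\<And>k. A (- k) = - A k"
    "\<And>k. \<not> [2 * k = 0] (mod int M) \<Longrightarrow> (\<exists>s. odd s \<and> A (q * k) = real_of_int q * A k + pi * real_of_int s)"
    using phase_function[OF M q(2)] by blast
  define b where "b k = A k / real_of_int (q - 1)" for k
  have b: "\<And>k l. [k = l] (mod int M) \<Longrightarrow> b k = b l" "\<And>k. b (- k) = - b k"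
    using A by (simp_all add: b_def)
  have Ab: "real_of_int (q - 1) * b k = A k" for k using q(3) by (simp add: b_def)
  define u where "u k = cis (b k)" for k
  define w where "w k = cis (real_of_int (q - 1) * (b k - pi / 4))" for k
  define e where "e = char_fun M"
  have w_uminus: "w (- k) = cnj (w k)" for k
  proof -
    \<comment> \<open>As \<open>q - 1 = 4 * r\<close>, conjugation changes the constant part of the
      phase by full turns only.\<close>
    have "real_of_int (q - 1) * (b (- k) - pi / 4)
        = - (real_of_int (q - 1) * (b k - pi / 4)) + 2 * pi * real_of_int (- r)"
      by (simp add: b qr algebra_simps)
    then have "w (- k) = cis (- (real_of_int (q - 1) * (b k - pi / 4)))"
      unfolding w_def by (simp only: cis_add_2pi_int)
    then show ?thesis by (simp add: w_def cis_cnj)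
  qed
  have "\<exists>G :: int \<Rightarrow> nat \<Rightarrow> complex.
     (\<forall>k l. (\<Sum>j<M. G k j * cnj (G l j)) = (if [k = l] (mod int M) then of_nat M else 0)) \<and>
     (\<forall>k j. G (- k) j = cnj (G k j)) \<and>
     (\<forall>k j. norm (G k j - u k * (of_real (1 - a\<^sup>2) * (e k j + of_real a * cnj (w (p * k)) * e (p * k) j)
        - of_real a * w k * e (q * k) j)) \<le> a\<^sup>2 * (1 + a)) \<and>
     (\<forall>k j. [2 * k = 0] (mod int M) \<longrightarrow> G k j = u k * e k j)"
    unfolding e_def
    by (rule all_pass_rows[OF M pq q(1)])
       (use b a w_uminus in \<open>simp_all add: u_def w_def cis_cnj\<close>)
  then obtain G :: "int \<Rightarrow> nat \<Rightarrow> complex" where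
    G_orth: "\<And>k l. (\<Sum>j<M. G k j * cnj (G l j)) = (if [k = l] (mod int M) then of_nat M else 0)" and
    G_cnj: "\<And>k j. G (- k) j = cnj (G k j)" and
    G_approx: "\<And>k j. norm (G k j - u k * (of_real (1 - a\<^sup>2) * (e k j + of_real a * cnj (w (p * k)) * e (p * k) j)
        - of_real a * w k * e (q * k) j)) \<le> a\<^sup>2 * (1 + a)" and
    G_real: "\<And>k j. [2 * k = 0] (mod int M) \<Longrightarrow> G k j = u k * e k j"
    by blast
  have bound: "\<bar>Re (G k j) + Im (G k j)\<bar> \<le> sqrt 2 * \<kappa>" for k j
  proof (cases "[2 * k = 0] (mod int M)")
    \<comment> \<open>At self-conjugate frequencies the row is unfiltered and real of modulus 1,
      which \<open>\<kappa> \<ge> 3/4\<close> covers.\<close>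
    case True
    then have "[- k = k] (mod int M)" by (simp add: cong_iff_dvd_diff)
    then have eq: "u (- k) = u k" "e (- k) j = e k j"
      using b(1) char_fun_cong[OF M] by (auto simp: u_def e_def)
    have "G (- k) j = G k j"
      using G_real[of "- k" j] G_real[OF True, of j] True eq by (simp add: cong_iff_dvd_diff)
    then have "Im (G k j) = 0" using G_cnj[of k j] by (simp add: complex_eq_iff)
    moreover have "norm (G k j) = 1"
      using G_real[OF True] by (simp add: norm_mult u_def e_def norm_char_fun)
    ultimately have "\<bar>Re (G k j) + Im (G k j)\<bar> \<le> 1" using abs_Re_le_cmod[of "G k j"] by simp
    also have "1 \<le> sqrt 2 * \<kappa>"
    proof -
      have "1 \<le> sqrt 2 * (3/4)" by (rule power2_le_imp_le) (simp_all add: power_mult_distrib power_divide)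
      also have "\<dots> \<le> sqrt 2 * \<kappa>" using \<kappa> by (intro mult_left_mono) auto
      finally show ?thesis .
    qed
    finally show ?thesis .
  next
    case False
    define k' where "k' = p * k"
    have qk': "[q * k' = k] (mod int M)"
      using cong_scalar_right[OF pq, of k] by (simp add: k'_def algebra_simps)
    have "\<not> [2 * k' = 0] (mod int M)"
    proof
      assume "[2 * k' = 0] (mod int M)"
      from cong_scalar_left[OF this, of q] have "[2 * (q * k') = 0] (mod int M)" by (simp add: algebra_simps)
      then show False using False cong_scalar_left[OF qk', of 2] by (meson cong_sym cong_trans)
    qed
    from A(3)[OF this] obtain s where s: "odd s" "A (q * k') = real_of_int q * A k' + pi * real_of_int s"
      by blast
    have As: "A k = real_of_int q * A k' + pi * real_of_int s" using A(1)[OF qk'] s(2) by simp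
    obtain t where t: "k = q * k' + int M * t" using qk' by (metis cong_iff_lin)
    define \<theta> where "\<theta> = b k - pi / 4 + 2 * pi * real_of_int k * real j / real M"
    define y where "y = b k - pi / 4 - real_of_int (q - 1) * (b k' - pi / 4)
      + 2 * pi * real_of_int k' * real j / real M"
    \<comment> \<open>\<open>y\<close> is the angle of the incoming term, at the preimage frequency
      \<open>k'\<close>. The multiple of \<open>pi\<close> has the parity of \<open>s\<close>, hence
      is odd.\<close>
    have angle: "\<theta> = q * y - pi * real_of_int (s + 4 * r\<^sup>2 - 2 * t * int j)"
    proof -
      have kj: "2 * pi * real_of_int k * real j / real M
          = q * (2 * pi * real_of_int k' * real j / real M) + 2 * pi * real_of_int t * real j"
        using M by (simp add: t field_simps)
      have "\<theta> - q * y = - (real_of_int (q - 1) * b k) + q * (real_of_int (q - 1) * b k')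
          + real_of_int (q - 1) * pi / 4 - q * (real_of_int (q - 1) * pi / 4)
          + 2 * pi * real_of_int t * real j"
        unfolding \<theta>_def y_def kj by (simp add: algebra_simps add_divide_distrib diff_divide_distrib)
      also have "\<dots> = - (pi * real_of_int s) - (real_of_int (q - 1))\<^sup>2 * pi / 4 + 2 * pi * real_of_int t * real j"
        unfolding Ab As by (simp add: algebra_simps power2_eq_square add_divide_distrib diff_divide_distrib)
      also have "real_of_int (q - 1) = 4 * real_of_int r" by (simp add: qr)
      finally show ?thesis by (simp add: algebra_simps power2_eq_square)
    qed
    have odd_s: "odd (s + 4 * r\<^sup>2 - 2 * t * int j)" using s(1) by simp
    have cos_\<theta>: "cos \<theta> = - cos (q * y)" unfolding angle by (rule cos_minus_odd_pi[OF odd_s])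
    have cos_q\<theta>: "cos (q * \<theta>) = - cos (q * (q * y))"
    proof -
      have eq: "q * \<theta> = q * (q * y) - pi * real_of_int (q * (s + 4 * r\<^sup>2 - 2 * t * int j))"
        unfolding angle by (simp add: algebra_simps)
      have "odd (q * (s + 4 * r\<^sup>2 - 2 * t * int j))" using odd_s q(1) by simp
      then show ?thesis unfolding eq by (rule cos_minus_odd_pi)
    qed
    \<comment> \<open>Rotation by \<open>- pi / 4\<close> turns \<open>Re + Im\<close> into
      \<open>sqrt 2\<close> times the real part.\<close>
    define \<eta> where "\<eta> = cis (- pi / 4)"
    have ue: "\<eta> * (u k * e k j) = cis \<theta>"
      by (simp add: \<eta>_def u_def e_def char_fun_def \<theta>_def cis_mult algebra_simps)
    have uwe: "\<eta> * (u k * (cnj (w (p * k)) * e (p * k) j)) = cis y"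
      by (simp add: \<eta>_def u_def w_def e_def char_fun_def y_def k'_def cis_cnj cis_mult algebra_simps)
    have uwqe: "\<eta> * (u k * (w k * e (q * k) j)) = cis (q * \<theta>)"
      by (simp add: \<eta>_def u_def w_def e_def char_fun_def \<theta>_def cis_mult algebra_simps diff_divide_distrib)
    define Z where "Z = of_real (1 - a\<^sup>2) * (cis \<theta> + of_real a * cis y) - of_real a * cis (q * \<theta>)"
    have "\<eta> * (G k j - u k * (of_real (1 - a\<^sup>2) * (e k j + of_real a * cnj (w (p * k)) * e (p * k) j)
        - of_real a * w k * e (q * k) j)) = \<eta> * G k j - Z"
      unfolding Z_def ue[symmetric] uwe[symmetric] uwqe[symmetric] by (simp add: algebra_simps)
    then have "norm (\<eta> * G k j - Z) \<le> a\<^sup>2 * (1 + a)"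
      using G_approx[of k j] by (metis \<eta>_def mult_1 norm_cis norm_mult)
    then have "\<bar>Re (\<eta> * G k j) - Re Z\<bar> \<le> a\<^sup>2 * (1 + a)"
      using abs_Re_le_cmod[of "\<eta> * G k j - Z"] by simp
    moreover have "Re Z = a * cos (q * (q * y)) + (1 - a\<^sup>2) * (a * cos y - cos (q * y))"
    proof -
      have Re_scale: "Re (complex_of_real c * z) = c * Re z" for c z by simp
      have "Re Z = (1 - a\<^sup>2) * (cos \<theta> + a * cos y) - a * cos (q * \<theta>)"
        by (simp only: Z_def minus_complex.sel plus_complex.sel Re_scale cis.sel)
      then show ?thesis unfolding cos_\<theta> cos_q\<theta> by (simp add: algebra_simps)
    qed
    \<comment> \<open>The margin \<open>a\<^sup>2 * (1 + a)\<close> in \<open>sup\<close> pays for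
      the approximation error.\<close>
    ultimately have "\<bar>Re (\<eta> * G k j)\<bar> \<le> \<kappa>" using sup[of y] by linarith
    moreover have "Re (G k j) + Im (G k j) = sqrt 2 * Re (\<eta> * G k j)"
      by (simp add: \<eta>_def cos_45 sin_45 algebra_simps)
    ultimately show ?thesis by (simp add: abs_mult)
  qed
  show ?thesis
  proof (rule flat_orthogonal_hartley[OF M G_orth G_cnj])
    fix k j
    have "b 0 = 0" using b(2)[of 0] by simp
    then show "G 0 j = 1" using G_real[of 0 j] by (simp add: u_def e_def char_fun_def)
    have "\<bar>Re (G k j) + Im (G k j)\<bar> * (sqrt (M / 2) / \<kappa>) \<le> sqrt 2 * \<kappa> * (sqrt (M / 2) / \<kappa>)"
      using bound[of k j] \<kappa> by (intro mult_right_mono) auto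
    also have "\<dots> = sqrt M" using \<kappa> by (simp add: real_sqrt_divide)
    finally show "\<bar>Re (G k j) + Im (G k j)\<bar> * (sqrt (M / 2) / \<kappa>) \<le> sqrt M" .
  qed
qed

section \<open>Bounds for the filtered cosine\<close>

lemma chebyshev_3: "cos (3 * x) = 4 * cos x ^ 3 - 3 * cos (x::real)"
  by (rule cos_treble_cos)

lemma chebyshev_5: "cos (5 * x) = 16 * cos x ^ 5 - 20 * cos x ^ 3 + 5 * cos (x::real)"
proof -
  have "cos (5 * x) = cos (3 * x) * cos (2 * x) - sin (3 * x) * sin (2 * x)"
    using cos_add[of "3 * x" "2 * x"] by simp
  also have "\<dots> = cos (3 * x) * (2 * (cos x)\<^sup>2 - 1) - sin (3 * x) * (2 * sin x * cos x)"
    by (simp only: cos_double_cos sin_double)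
  also have "sin (3 * x) = sin x * (4 * (cos x)\<^sup>2 - 1)"
  proof -
    have "sin (3 * x) = sin x * cos (2 * x) + cos x * sin (2 * x)" using sin_add[of x "2 * x"] by simp
    then show ?thesis unfolding cos_double_cos sin_double by (simp add: algebra_simps power2_eq_square)
  qed
  also have "sin x * (4 * (cos x)\<^sup>2 - 1) * (2 * sin x * cos x) = (1 - (cos x)\<^sup>2) * (4 * (cos x)\<^sup>2 - 1) * (2 * cos x)"
    unfolding sin_squared_eq[symmetric] by (simp add: power2_eq_square)
  finally show ?thesis
    unfolding chebyshev_3 by (simp add: algebra_simps eval_nat_numeral)
qed

lemma chebyshev_7: "cos (7 * x) = 64 * cos x ^ 7 - 112 * cos x ^ 5 + 56 * cos x ^ 3 - 7 * cos (x::real)"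
proof -
  have "cos (7 * x) = 2 * cos (5 * x) * cos (2 * x) - cos (3 * x)"
    using cos_plus_cos[of "7 * x" "3 * x"] by simp
  then show ?thesis
    unfolding chebyshev_3 chebyshev_5 cos_double_cos by (simp add: algebra_simps eval_nat_numeral)
qed

text \<open>By half angles this is the square of
  \<open>\<bar>sin (n * t)\<bar> \<le> n * \<bar>sin t\<bar>\<close> at
  \<open>t = x / 2\<close>.\<close>

lemma cos_multiple_ge:
  fixes x :: real
  shows "1 - (real n)\<^sup>2 * (1 - cos x) \<le> cos (n * x)"
proof -
  have half: "1 - cos z = 2 * (sin (z / 2))\<^sup>2" for z :: real
    using cos_double_sin[of "z / 2"] by simp
  have "\<bar>sin (n * t)\<bar> \<le> n * \<bar>sin t\<bar>" for t :: real
  proof (induction n)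
    case (Suc n)
    have "\<bar>sin (Suc n * t)\<bar> \<le> \<bar>sin (n * t) * cos t\<bar> + \<bar>cos (n * t) * sin t\<bar>"
      by (simp add: distrib_right sin_add algebra_simps)
    also have "\<dots> \<le> \<bar>sin (n * t)\<bar> * 1 + 1 * \<bar>sin t\<bar>"
      unfolding abs_mult by (intro add_mono mult_mono) auto
    finally show ?case using Suc by (simp add: algebra_simps)
  qed simp
  then have "\<bar>sin (n * (x / 2))\<bar> \<le> n * \<bar>sin (x / 2)\<bar>" .
  from power_mono[OF this abs_ge_zero, of 2] have "1 - cos (n * x) \<le> (real n)\<^sup>2 * (1 - cos x)"
    unfolding half[of x] half[of "n * x"] by (simp add: power_mult_distrib)
  then show ?thesis by simp
qed

lemma cos_odd_multiple_shift:
  assumes "odd n"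
  shows "cos (real_of_int n * (y + pi)) = - cos (real_of_int n * y)"
proof -
  obtain m where m: "n = 2 * m + 1" using assms by (elim oddE)
  have "real_of_int n * (y + pi) = (real_of_int n * y + pi) + real_of_int m * (2 * pi)" by (simp add: m algebra_simps)
  then have "cos (real_of_int n * (y + pi)) = cos (real_of_int n * y + pi)"
    by (simp add: cos_add cos_int_2pin sin_int_2pin mult.commute[of _ "2 * pi"])
  then show ?thesis by simp
qed

text \<open>It suffices to bound the expression from below, as it changes sign under \<open>y \<mapsto> y + \<pi>\<close>.\<close>

lemma odd_trig_abs_bound:
  fixes a B :: real and q :: int
  assumes q: "odd q"
    and lower: "\<And>y. - B \<le> a * cos (real_of_int q * (real_of_int q * y)) + (1 - a\<^sup>2) * (a * cos y - cos (real_of_int q * y))"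
  shows "\<bar>a * cos (real_of_int q * (real_of_int q * y)) + (1 - a\<^sup>2) * (a * cos y - cos (real_of_int q * y))\<bar> \<le> B"
proof -
  have "cos (real_of_int q * (real_of_int q * (y + pi))) = - cos (real_of_int q * (real_of_int q * y))"
    using cos_odd_multiple_shift[of "q * q" y] q by (simp add: mult.assoc)
  moreover have "cos (real_of_int q * (y + pi)) = - cos (real_of_int q * y)" using cos_odd_multiple_shift[OF q] .
  ultimately have "- B \<le> - (a * cos (real_of_int q * (real_of_int q * y)) + (1 - a\<^sup>2) * (a * cos y - cos (real_of_int q * y)))"
    using lower[of "y + pi"] by (simp add: algebra_simps)
  then show ?thesis using lower[of y] by linarith
qed

section \<open>The multipliers 3, 5 and 7\<close>

text \<open>All terms are polynomials in \<open>x = - cos y\<close> and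
  \<open>s = 1 - cos (3 * y)\<close>. Here \<open>9 * a\<close> slightly exceeds
  \<open>1 - a\<^sup>2\<close>, so the linear coefficient of \<open>s\<close> is negative and the
  quadratic term has to compensate.\<close>

lemma sup_bound_3:
  "\<bar>(11/100) * cos (real_of_int (- 3) * (real_of_int (- 3) * y)) + (1 - (11/100)\<^sup>2) * ((11/100) * cos y - cos (real_of_int (- 3) * y))\<bar>
    \<le> (9535/10000) - (11/100)\<^sup>2 * (1 + (11/100))"
proof (rule odd_trig_abs_bound)
  fix y :: real
  define x where "x = - cos y"
  define s where "s = (1 + x) * (2 * x - 1)\<^sup>2"
  have x: "- 1 \<le> x" "x \<le> 1" using cos_ge_minus_one[of y] cos_le_one[of y] by (auto simp: x_def)
  have t: "cos (3 * y) = 1 - s"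
    unfolding chebyshev_3 by (simp add: s_def x_def algebra_simps power2_eq_square power3_eq_cube)
  have s: "0 \<le> s" "s \<le> 2" using x t cos_ge_minus_one[of "3 * y"] by (auto simp: s_def)
  have "cos (3 * (3 * y)) = 1 - 9 * s + 12 * s\<^sup>2 - 4 * s ^ 3"
    unfolding chebyshev_3[of "3 * y"] t by (simp add: algebra_simps power2_eq_square power3_eq_cube)
  then have tt: "cos (9 * y) = 1 - 9 * s + 12 * s\<^sup>2 - 4 * s ^ 3" by simp
  have key: "(108669/1000000) * x \<le> (62169/1000000) - (21/10000) * s + (132/100) * s\<^sup>2 - (44/100) * s ^ 3"
  proof -
    have s3: "s ^ 3 \<le> 2 * s\<^sup>2" using s mult_right_mono[of s 2 "s\<^sup>2"] by (simp add: power3_eq_cube power2_eq_square)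
    have base: "(62169/1000000) - (21/10000) * s + (44/100) * s\<^sup>2 \<le> (62169/1000000) - (21/10000) * s + (132/100) * s\<^sup>2 - (44/100) * s ^ 3"
      using s3 by simp
    \<comment> \<open>A tangent line of the square; \<open>q\<close> and \<open>h\<close> below
      arise in the same way and leave linear inequalities.\<close>
    have "0 \<le> (s - (24/10000))\<^sup>2" by simp
    then have sq: "(48/10000) * s - (576/100000000) \<le> s\<^sup>2" by (simp add: power2_eq_square algebra_simps)
    consider "x \<le> (572/1000)" | "(572/1000) \<le> x" "s \<le> 1" | "1 \<le> s" by linarith
    then show ?thesis
    proof cases
      case 1
      have "(62166/1000000) \<le> (62169/1000000) - (21/10000) * s + (44/100) * s\<^sup>2"
        using sq s by linarith
      then show ?thesis using base 1 by linarith
    next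
      case 2
      \<comment> \<open>\<open>s0\<close> is a lower bound for \<open>s\<close>, as
        \<open>1 + x\<close> is at least \<open>1572/1000\<close>.\<close>
      define v where "v = (2 * x - 1)\<^sup>2"
      define s0 where "s0 = (1572/1000) * v"
      have v: "(207/10000) \<le> v" using 2 power_mono[of "(144/1000)" "2 * x - 1" 2] by (simp add: v_def power2_eq_square)
      have "0 \<le> (x - (572/1000)) * v" using 2 by (simp add: v_def)
      then have s0: "s0 \<le> s" by (simp add: s0_def s_def v_def algebra_simps)
      have "0 \<le> (s - s0) * ((88/100) * (s + s0) - (21/10000))" using s0 v by (intro mult_nonneg_nonneg) (auto simp: s0_def)
      then have mono: "(88/100) * s0\<^sup>2 - (21/10000) * s0 \<le> (88/100) * s\<^sup>2 - (21/10000) * s"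
        by (simp add: field_simps power2_eq_square)
      have "s ^ 3 \<le> s\<^sup>2" using s 2 by (intro power_decreasing) auto
      then have cub: "(62169/1000000) - (21/10000) * s + (88/100) * s\<^sup>2 \<le> (62169/1000000) - (21/10000) * s + (132/100) * s\<^sup>2 - (44/100) * s ^ 3"
        by simp
      have "0 \<le> (v - (361/10000))\<^sup>2" by simp
      then have q: "(722/10000) * v - (130321/100000000) \<le> v\<^sup>2" by (simp add: power2_eq_square algebra_simps)
      have "s0\<^sup>2 = (2471184/1000000) * v\<^sup>2" by (simp add: s0_def power2_eq_square)
      then have low: "(1535/10000) * v - (2835/1000000) \<le> (88/100) * s0\<^sup>2 - (21/10000) * s0"
        using q v unfolding s0_def by linarith
      have "0 \<le> (2 * x - 1 - (177/1000))\<^sup>2" by simp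
      then have h: "708/1000 * x - 385329/1000000 \<le> v" by (simp add: v_def power2_eq_square field_simps)
      then have "(108669/1000000) * x \<le> (62169/1000000) + (1535/10000) * v - (2835/1000000)" using 2 by linarith
      then show ?thesis using low mono cub by linarith
    next
      case 3
      have "1 \<le> s\<^sup>2" using 3 by simp
      then show ?thesis using base x s by linarith
    qed
  qed
  show "- ((9535/10000) - (11/100)\<^sup>2 * (1 + (11/100))) \<le> (11/100) * cos (real_of_int (- 3) * (real_of_int (- 3) * y)) + (1 - (11/100)\<^sup>2) * ((11/100) * cos y - cos (real_of_int (- 3) * y))"
  proof -
    have "cos (real_of_int (- 3) * (real_of_int (- 3) * y)) = cos (9 * y)" "cos (real_of_int (- 3) * y) = cos (3 * y)"
      by simp_all
    then show ?thesis unfolding tt t using key by (simp add: x_def power2_eq_square field_simps)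
  qed
qed simp

text \<open>Bounding the highest harmonic by \<open>cos_multiple_ge\<close> leaves an expression
  linear in \<open>cos y\<close> and \<open>cos (n * y)\<close>; the shift by \<open>pi\<close>
  turns it into \<open>key\<close>.\<close>

lemma sup_bound_linear:
  fixes a \<kappa> :: real and n :: nat and q :: int
  assumes q: "odd q" "\<bar>q\<bar> = int n" and a: "0 \<le> a" "a * (real n)\<^sup>2 \<le> 1 - a\<^sup>2"
    and key: "\<And>y :: real. a * (1 - a\<^sup>2) * cos y + 1 - a - a\<^sup>2 - (1 - a\<^sup>2 - a * (real n)\<^sup>2) * (1 + cos (n * y)) \<le> \<kappa> - a\<^sup>2 * (1 + a)"
  shows "\<bar>a * cos (real_of_int q * (real_of_int q * y)) + (1 - a\<^sup>2) * (a * cos (y :: real) - cos (real_of_int q * y))\<bar> \<le> \<kappa> - a\<^sup>2 * (1 + a)"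
proof (rule odd_trig_abs_bound[OF q(1)])
  fix y :: real
  have q_cases: "real_of_int q = n \<or> real_of_int q = - real n" using q(2) by linarith
  have cos_q: "cos (real_of_int q * z) = cos (n * z)" for z :: real using q_cases by auto
  have "cos (n * (y + pi)) = - cos (n * y)"
    using cos_odd_multiple_shift[OF q(1), of y] unfolding cos_q .
  moreover have "1 - (real n)\<^sup>2 * (1 - cos (n * y)) \<le> cos (n * (n * y))" by (rule cos_multiple_ge)
  then have "a * (1 - (real n)\<^sup>2 * (1 - cos (n * y))) \<le> a * cos (n * (n * y))"
    using a by (intro mult_left_mono)
  ultimately show "- (\<kappa> - a\<^sup>2 * (1 + a)) \<le> a * cos (real_of_int q * (real_of_int q * y)) + (1 - a\<^sup>2) * (a * cos y - cos (real_of_int q * y))"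
    using key[of "y + pi"] cos_q[of y] cos_q[of "q * y"] q_cases
    by (auto simp: algebra_simps)
qed

lemma sup_bound_5:
  "\<bar>(2/100) * cos (real_of_int 5 * (real_of_int 5 * y)) + (1 - (2/100)\<^sup>2) * ((2/100) * cos y - cos (real_of_int 5 * y))\<bar>
    \<le> (9974/10000) - (2/100)\<^sup>2 * (1 + (2/100))"
proof (rule sup_bound_linear[where n = 5])
  fix y :: real
  define x where "x = cos y"
  define s where "s = (1 + x) * (4 * x\<^sup>2 - 2 * x - 1)\<^sup>2"
  have x: "- 1 \<le> x" "x \<le> 1" by (auto simp: x_def)
  have t: "1 + cos (5 * y) = s"
    unfolding chebyshev_5 by (simp add: s_def x_def algebra_simps eval_nat_numeral)
  have s: "0 \<le> s" using x by (simp add: s_def)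
  \<comment> \<open>The constant suffices up to \<open>865/1000\<close>; beyond that,
    \<open>x\<close> is well past \<open>cos (pi / 5)\<close>, the largest root of
    \<open>4 * x\<^sup>2 - 2 * x - 1\<close>, and \<open>s\<close> takes over.\<close>
  have "(19992/1000000) * x \<le> (173/10000) + (4996/10000) * s"
  proof (cases "x \<le> (865/1000)")
    case True
    then show ?thesis using s by simp
  next
    case False
    then have "0 \<le> (x - (865/1000)) * (4 * (x + (865/1000)) - 2)" by (intro mult_nonneg_nonneg) auto
    then have "(26/100) \<le> 4 * x\<^sup>2 - 2 * x - 1" by (simp add: power2_eq_square algebra_simps)
    then have "(26/100)\<^sup>2 \<le> (4 * x\<^sup>2 - 2 * x - 1)\<^sup>2" by (intro power_mono) auto
    then have "(18/10) * (26/100)\<^sup>2 \<le> s" unfolding s_def using False by (intro mult_mono) auto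
    then show ?thesis using x by (simp add: power2_eq_square)
  qed
  then show "(2/100) * (1 - (2/100)\<^sup>2) * cos y + 1 - (2/100) - (2/100)\<^sup>2 - (1 - (2/100)\<^sup>2 - (2/100) * (real 5)\<^sup>2) * (1 + cos (real 5 * y))
      \<le> (9974/10000) - (2/100)\<^sup>2 * (1 + (2/100))"
    by (simp add: t x_def power2_eq_square)
qed (simp_all add: power2_eq_square)

lemma sup_bound_7:
  "\<bar>(2/100) * cos (real_of_int (- 7) * (real_of_int (- 7) * y)) + (1 - (2/100)\<^sup>2) * ((2/100) * cos y - cos (real_of_int (- 7) * y))\<bar>
    \<le> (99808/100000) - (2/100)\<^sup>2 * (1 + (2/100))"
proof (rule sup_bound_linear[where n = 7])
  fix y :: real
  define x where "x = cos y"
  define g where "g = 8 * x ^ 3 - 4 * x\<^sup>2 - 4 * x + 1"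
  define s where "s = (1 + x) * g\<^sup>2"
  have x: "- 1 \<le> x" "x \<le> 1" by (auto simp: x_def)
  have t: "1 + cos (7 * y) = s"
    unfolding chebyshev_7 by (simp add: s_def g_def x_def algebra_simps eval_nat_numeral)
  have s: "0 \<le> s" using x by (simp add: s_def)
  have "(19992/1000000) * x \<le> (1806/100000) + (196/10000) * s"
  proof (cases "x \<le> (9033/10000)")
    case True
    then show ?thesis using s by simp
  next
    case False
    \<comment> \<open>\<open>901/1000\<close> lies just above \<open>cos (pi / 7)\<close>, the
      largest root of \<open>g\<close>, so all Taylor coefficients of \<open>g\<close> there are
      positive.\<close>
    define z where "z = x - (901/1000)"
    have z: "(23/10000) \<le> z" using False by (simp add: z_def)
    have xz: "x = z + (901/1000)" by (simp add: z_def)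
    have "g = 8 * z ^ 3 + (17624/1000) * z\<^sup>2 + (8275224/1000000) * z + (257608/1000000000)"
      unfolding g_def xz by (simp add: field_simps eval_nat_numeral)
    moreover have "0 \<le> z ^ 3" "0 \<le> z\<^sup>2" using z by simp_all
    ultimately have "(82/10) * z \<le> g" using z by linarith
    then have "((82/10) * z)\<^sup>2 \<le> g\<^sup>2" using z by (intro power_mono) auto
    then have "(19/10) * ((82/10) * z)\<^sup>2 \<le> s" unfolding s_def using False by (intro mult_mono) auto
    then have s127: "(127756/1000) * z\<^sup>2 \<le> s" by (simp add: power_mult_distrib power2_eq_square)
    have "0 \<le> (z - (4/1000))\<^sup>2" by simp
    then have "(8/1000) * z - (16/1000000) \<le> z\<^sup>2" by (simp add: power2_eq_square algebra_simps)
    then show ?thesis using s127 xz z by linarith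
  qed
  then show "(2/100) * (1 - (2/100)\<^sup>2) * cos y + 1 - (2/100) - (2/100)\<^sup>2 - (1 - (2/100)\<^sup>2 - (2/100) * (real 7)\<^sup>2) * (1 + cos (real 7 * y))
      \<le> (99808/100000) - (2/100)\<^sup>2 * (1 + (2/100))"
    by (simp add: t x_def power2_eq_square)
qed (simp_all add: power2_eq_square)

section \<open>All dimensions\<close>

lemma flat_orthogonal_delete_many:
  assumes "flat_orthogonal M f" "r + 2 \<le> M" "real r < f"
  shows "flat_orthogonal (M - r) (f - r)"
  using assms(2,3)
proof (induction r)
  case (Suc r)
  then have "flat_orthogonal (M - r - 1) (f - r - 1)" by (intro flat_orthogonal_delete) auto
  then show ?case by (simp add: algebra_simps)
qed (use assms(1) in simp)

text \<open>The sign of the multiplier \<open>- 3\<close> makes it 1 modulo 4, as the choice of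
  phases demands.\<close>

lemma flat_orthogonal_fourier_3:
  assumes "\<not> 3 dvd M"
  shows "flat_orthogonal M (sqrt (M / 2) / (9535/10000))"
proof (rule flat_orthogonal_fourier[where q = "- 3" and r = "- 1" and a = "11/100"])
  show "coprime (- 3) (int M)" using assms prime_imp_coprime[of "3 :: int" "int M"] by simp presburger
qed (use assms sup_bound_3 in \<open>auto simp: power2_eq_square intro: gr0I\<close>)

lemma flat_orthogonal_fourier_5:
  assumes "\<not> 5 dvd M"
  shows "flat_orthogonal M (sqrt (M / 2) / (9974/10000))"
proof (rule flat_orthogonal_fourier[where q = 5 and r = 1 and a = "2/100"])
  show "coprime 5 (int M)" using assms prime_imp_coprime[of "5 :: int" "int M"] by simp presburger
qed (use assms sup_bound_5 in \<open>auto simp: power2_eq_square intro: gr0I\<close>)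

lemma flat_orthogonal_fourier_7:
  assumes "\<not> 7 dvd M"
  shows "flat_orthogonal M (sqrt (M / 2) / (99808/100000))"
proof (rule flat_orthogonal_fourier[where q = "- 7" and r = "- 2" and a = "2/100"])
  show "coprime (- 7) (int M)" using assms prime_imp_coprime[of "7 :: int" "int M"] by simp presburger
qed (use assms sup_bound_7 in \<open>auto simp: power2_eq_square intro: gr0I\<close>)

lemma sqrt_le_sqrt_divide:
  fixes x y \<kappa> :: real
  assumes "\<kappa> > 0" "x * \<kappa>\<^sup>2 \<le> y"
  shows "sqrt x \<le> sqrt y / \<kappa>"
proof -
  have "sqrt x * \<kappa> = sqrt (x * \<kappa>\<^sup>2)" using assms(1) by (simp add: real_sqrt_mult)
  also have "\<dots> \<le> sqrt y" using assms(2) by simp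
  finally show ?thesis using assms(1) by (simp add: field_simps)
qed

lemma prime_by_trial_division:
  fixes n k :: nat
  assumes "1 < n" "n < k * k" "\<forall>d\<in>set [2..<k]. \<not> d dvd n"
  shows "prime n"
  unfolding prime_nat_iff
proof (intro conjI allI impI assms(1))
  fix m assume "m dvd n"
  then obtain j where j: "n = m * j" by (elim dvdE)
  show "m = 1 \<or> m = n"
  proof (rule ccontr)
    assume m: "\<not> (m = 1 \<or> m = n)"
    have "m \<noteq> 0" using j assms(1) by (intro notI) simp
    moreover have "j \<noteq> 0" using j assms(1) by (intro notI) simp
    moreover have "j \<noteq> 1" using m j by auto
    ultimately have "2 \<le> m" "2 \<le> j" using m by linarith+
    moreover have "m < k \<or> j < k"
      using assms(2) mult_le_mono[of k m k j] unfolding j by linarith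
    moreover have "m dvd n" "j dvd n" unfolding j by simp_all
    ultimately show False using assms(3) by auto
  qed
qed

text \<open>The orders come from \<open>210 = 212 - 2\<close>, \<open>315 = 4 * 80 - 5\<close>,
  \<open>525 = 4 * 132 - 3\<close>, \<open>735 = 2 * 368 - 1\<close> by doubling and deletion, and
  420, 840, 630 by further doubling. The decimals are lower bounds for the resulting
  \<open>f\<close>.\<close>

lemma flat_orthogonal_multiples_of_105:
  assumes "105 dvd N" "200 < N" "N < 900"
  shows "flat_orthogonal N (sqrt (5024862/10000000 * real (N - 1)))"
proof -
  have root2: "141/100 \<le> sqrt 2" by (rule real_le_rsqrt) (simp add: power2_eq_square)
  have paley: "flat_orthogonal (q + 1) (sqrt (q + 1))"
    if "1 < q" "q < 20 * 20" "\<forall>d\<in>set [2..<20]. \<not> d dvd q" "q mod 4 = 3" for q :: nat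
    using prime_by_trial_division[OF that(1-3)] that(4) by (rule flat_orthogonal_paley)
  have divs: "\<forall>d\<in>set [2..<20]. \<not> d dvd (211::nat)" "\<forall>d\<in>set [2..<20]. \<not> d dvd (79::nat)"
      "\<forall>d\<in>set [2..<20]. \<not> d dvd (131::nat)" "\<forall>d\<in>set [2..<20]. \<not> d dvd (367::nat)"
    by code_simp+
  \<comment> \<open>211, 79, 131 and 367 are primes congruent to 3 modulo 4.\<close>
  have P: "flat_orthogonal 212 (sqrt 212)" "flat_orthogonal 80 (sqrt 80)"
      "flat_orthogonal 132 (sqrt 132)" "flat_orthogonal 368 (sqrt 368)"
    using paley[OF _ _ divs(1)] paley[OF _ _ divs(2)] paley[OF _ _ divs(3)] paley[OF _ _ divs(4)]
    by simp_all
  have r212: "145/10 \<le> sqrt 212" and r80: "894/100 \<le> sqrt 80" and r132: "114/10 \<le> sqrt 132" and r368: "19 \<le> sqrt 368"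
    by (rule real_le_rsqrt, simp add: power2_eq_square)+
  have F210: "flat_orthogonal 210 (125/10)"
    using flat_orthogonal_delete_many[OF P(1), of 2] r212
    by (auto elim!: flat_orthogonal_mono)
  have dbl: "flat_orthogonal n f'" if "flat_orthogonal m f" "f' \<le> 141/100 * f" "0 \<le> f" "n = 2 * m" for m n f f'
  proof -
    have "f' \<le> sqrt 2 * f" using that(2) mult_right_mono[OF root2 that(3)] by linarith
    then show ?thesis using flat_orthogonal_double[OF that(1)] flat_orthogonal_mono that(4) by blast
  qed
  have F420: "flat_orthogonal 420 (176/10)" by (rule dbl[OF F210]) simp_all
  have F840: "flat_orthogonal 840 24" by (rule dbl[OF F420]) simp_all
  have F320: "flat_orthogonal 320 (1788/100)"
  proof -
    have "flat_orthogonal (2 * (2 * 80)) (sqrt 2 * (sqrt 2 * sqrt 80))"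
      by (intro flat_orthogonal_double P)
    then have "flat_orthogonal 320 (2 * sqrt 80)" by (simp add: mult.assoc[symmetric])
    then show ?thesis by (rule flat_orthogonal_mono) (use r80 in simp)
  qed
  have F315: "flat_orthogonal 315 (1288/100)"
    using flat_orthogonal_delete_many[OF F320, of 5] by simp
  have F630: "flat_orthogonal 630 (181/10)"
    by (rule dbl[OF F315]) simp_all
  have F528: "flat_orthogonal 528 (22)"
  proof -
    have "flat_orthogonal (2 * (2 * 132)) (sqrt 2 * (sqrt 2 * sqrt 132))"
      by (intro flat_orthogonal_double P)
    then have "flat_orthogonal 528 (2 * sqrt 132)" by (simp add: mult.assoc[symmetric])
    then show ?thesis by (rule flat_orthogonal_mono) (use r132 in simp)
  qed
  have F525: "flat_orthogonal 525 19"
    using flat_orthogonal_delete_many[OF F528, of 3] by simp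
  have F736: "flat_orthogonal 736 26"
  proof -
    have "141/100 * 19 \<le> sqrt 2 * sqrt 368" using root2 r368 by (intro mult_mono) auto
    then show ?thesis using flat_orthogonal_double[OF P(4)] flat_orthogonal_mono[of 736 "sqrt 2 * sqrt 368" 26] by simp
  qed
  have F735: "flat_orthogonal 735 25"
    using flat_orthogonal_delete_many[OF F736, of 1] by simp
  have le: "flat_orthogonal m f \<Longrightarrow> m = N \<Longrightarrow> 5024862/10000000 * real (m - 1) \<le> f\<^sup>2 \<Longrightarrow> 0 \<le> f \<Longrightarrow> ?thesis" for m f
    using flat_orthogonal_mono[of m f] real_le_lsqrt by blast
  obtain k where "N = 105 * k" using assms(1) by (elim dvdE)
  moreover from this have "2 \<le> k" "k \<le> 8" using assms by linarith+
  then have "k = 2 \<or> k = 3 \<or> k = 4 \<or> k = 5 \<or> k = 6 \<or> k = 7 \<or> k = 8" by linarith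
  ultimately consider "N = 210" | "N = 315" | "N = 420" | "N = 525" | "N = 630" | "N = 735" | "N = 840"
    by auto
  then show ?thesis
  proof cases
    case 1 then show ?thesis by (intro le[OF F210]) (simp_all add: power2_eq_square)
  next
    case 2 then show ?thesis by (intro le[OF F315]) (simp_all add: power2_eq_square)
  next
    case 3 then show ?thesis by (intro le[OF F420]) (simp_all add: power2_eq_square)
  next
    case 4 then show ?thesis by (intro le[OF F525]) (simp_all add: power2_eq_square)
  next
    case 5 then show ?thesis by (intro le[OF F630]) (simp_all add: power2_eq_square)
  next
    case 6 then show ?thesis by (intro le[OF F735]) (simp_all add: power2_eq_square)
  next
    case 7 then show ?thesis by (intro le[OF F840]) (simp_all add: power2_eq_square)
  qed
qed

lemma flat_orthogonal_exists:
  assumes n: "n \<ge> 1"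
  shows "flat_orthogonal (n + 1) (sqrt (5024862/10000000 * real n))"
proof -
  consider "n \<le> 201" | "\<not> 3 dvd n + 1" | "201 < n" "\<not> 5 dvd n + 1" | "3 dvd n + 1" "899 \<le> n"
    | "201 < n" "n < 899" "\<not> 7 dvd n + 1" "15 dvd n + 1"
    | "201 < n" "n < 899" "7 dvd n + 1" "15 dvd n + 1"
  proof (cases "3 dvd n + 1 \<and> 5 dvd n + 1")
    case True
    then have "15 dvd n + 1" by presburger
    then show thesis using that True by linarith
  next
    case False
    then show thesis using that by linarith
  qed
  then show ?thesis
  proof cases
    case 1
    \<comment> \<open>The excess \<open>24862/10000000 * n\<close> over \<open>n / 2\<close> stays
      below \<open>1/2\<close> up to \<open>n = 201\<close>.\<close>
    have "flat_orthogonal (n + 1) (sqrt (real (n + 1) / 2))" by (rule flat_orthogonal_trivial) simp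
    then show ?thesis by (rule flat_orthogonal_mono) (use 1 in simp)
  next
    case 2
    show ?thesis by (rule flat_orthogonal_mono[OF flat_orthogonal_fourier_3[OF 2]], rule sqrt_le_sqrt_divide)
      (simp_all add: power2_eq_square)
  next
    case 3
    show ?thesis by (rule flat_orthogonal_mono[OF flat_orthogonal_fourier_5[OF 3(2)]], rule sqrt_le_sqrt_divide)
      (simp_all add: power2_eq_square)
  next
    case 4
    have "\<not> 3 dvd n + 2" using 4(1) by presburger
    from flat_orthogonal_fourier_3[OF this]
    have F: "flat_orthogonal (n + 2) (sqrt (real (n + 2) / 2) / (9535/10000))" .
    define x where "x = sqrt (5024862/10000000 * real n)"
    have x2: "x\<^sup>2 = 5024862/10000000 * real n" by (simp add: x_def)
    \<comment> \<open>This is what \<open>n \<ge> 899\<close> provides: from here on, the gain at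
      order \<open>n + 2\<close> outweighs one deletion.\<close>
    have x: "2125/100 \<le> x" unfolding x_def using 4 by (intro real_le_rsqrt) (simp add: power2_eq_square)
    then have "2125/100 * x \<le> x\<^sup>2" unfolding power2_eq_square by (intro mult_right_mono) auto
    then have "(x + 1)\<^sup>2 * (9535/10000)\<^sup>2 \<le> real (n + 2) / 2"
      using x2 by (simp add: power2_sum) (simp add: power2_eq_square algebra_simps)
    from sqrt_le_sqrt_divide[OF _ this] have le: "x + 1 \<le> sqrt (real (n + 2) / 2) / (9535/10000)"
      using x by simp
    then have "1 < sqrt (real (n + 2) / 2) / (9535/10000)" using x by linarith
    from flat_orthogonal_delete[OF F _ this]
    have "flat_orthogonal (n + 1) (sqrt (real (n + 2) / 2) / (9535/10000) - 1)" using 4 by simp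
    then show ?thesis by (rule flat_orthogonal_mono) (use le in \<open>simp add: x_def\<close>)
  next
    case 5
    \<comment> \<open>The largest multiple of 15 below 900 is 885; the constant for 7 would fail
      shortly before 899.\<close>
    then have "n \<le> 884" by presburger
    then show ?thesis
      by (intro flat_orthogonal_mono[OF flat_orthogonal_fourier_7[OF 5(3)]] sqrt_le_sqrt_divide)
        (simp_all add: power2_eq_square)
  next
    case 6
    then have "105 dvd n + 1" by presburger
    from flat_orthogonal_multiples_of_105[OF this] show ?thesis using 6 by simp
  qed
qed

text \<open>The squared left-hand side is \<open>x\<close> times
  \<open>(sqrt 336 - 4 - sqrt 2)\<^sup>2 / 332\<close>, and \<open>5024862/10000000\<close> is this
  factor rounded up.\<close>

lemma edge_length_bound:
  "(sqrt 336 - 4 - sqrt 2) / sqrt 664 * sqrt x * sqrt 2 \<le> sqrt (5024862/10000000 * x)"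
  if "x \<ge> 0"
proof -
  have "sqrt 336 \<le> 18330303/1000000" by (rule real_le_lsqrt) (simp_all add: power2_eq_square)
  moreover have "14142135/10000000 \<le> sqrt 2" by (rule real_le_rsqrt) (simp add: power2_eq_square)
  ultimately have "sqrt 336 - 4 - sqrt 2 \<le> 129160895/10000000" by linarith
  moreover have "18 \<le> sqrt 336" by (rule real_le_rsqrt) simp
  moreover have "sqrt 2 \<le> 2" by (rule real_le_lsqrt) simp_all
  ultimately have "(sqrt 336 - 4 - sqrt 2)\<^sup>2 \<le> (129160895/10000000)\<^sup>2" by (intro power_mono) linarith+
  then have "(sqrt 336 - 4 - sqrt 2)\<^sup>2 \<le> 5024862/10000000 * 332"
    by (rule order_trans) (simp add: power2_eq_square)
  from mult_right_mono[OF this that]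
  have "((sqrt 336 - 4 - sqrt 2) / sqrt 664 * sqrt x * sqrt 2)\<^sup>2 \<le> 5024862/10000000 * x"
    using that by (simp add: power_mult_distrib power_divide mult_ac)
  then show ?thesis by (rule real_le_rsqrt)
qed

theorem theorem1:
  shows "\<exists>V :: (real ^ 'n) set.
    regular_simplex_vertices ((sqrt 336 - 4 - sqrt 2) / sqrt 664 * sqrt (real CARD('n))) V \<and>
    vertex_barycenter V = 0 \<and>
    convex hull V \<subseteq> unit_hypercube"
proof (rule regular_simplex_from_flat_orthogonal)
  show "flat_orthogonal (CARD('n) + 1) (sqrt (5024862/10000000 * real CARD('n)))"
    by (rule flat_orthogonal_exists) (simp add: Suc_le_eq)
  have "18 \<le> sqrt 336" by (rule real_le_rsqrt) simp
  moreover have "sqrt 2 \<le> 2" by (rule real_le_lsqrt) simp_all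
  ultimately show "0 < (sqrt 336 - 4 - sqrt 2) / sqrt 664 * sqrt (real CARD('n))" by simp
  show "(sqrt 336 - 4 - sqrt 2) / sqrt 664 * sqrt (real CARD('n)) * sqrt 2
      \<le> sqrt (5024862/10000000 * real CARD('n))"
    by (rule edge_length_bound) simp
qed

end
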